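(* Suppose $\mathcal{X}$ is compact and there are constants $C>1$ and $V>0$ such that for all $\epsilon\in(0,1)$, $$\sup_m N_m(\epsilon,\mathcal{H})\le C\epsilon^{-V},$$ where the supremum is over all discrete probability measures $m$ on $\mathcal{X}$. There exists a constant $K>0$, not depending on $N$, $\delta$, $S$ or $\mu$, such that for every number of data $N\in\mathbb{N}$ and every $\delta\in(0,1)$, with probability at least $1-\delta$ over the random choice of $S$, for all $h_\mu\in\mathcal{G}$, $$\mathbb{P}_D[Yh_\mu(X)\le 0]\le \frac{K}{N}\log\left(\frac1\delta\right)+K\inf_{\rho\in(0,1]}\left(\mathbb{P}_S[Yh_\mu(X)\le\rho]+\rho^{\frac{-V}{V+1}}N^{\frac{-(V+2)}{2(V+1)}}\right).$$
   Context: $\mathcal{X}\subset\mathbb{R}^n$ is a Borel measurable feature space, $\mathcal{Y}=\{-1,1\}$, $\Theta\subset\mathbb{R}^d$ is a Borel set. $\mathcal{H}=\{h_\theta:\mathcal{X}\to[-1,1]\mid\theta\in\Theta\}$ is a family of Borel measurable base classifiers; $h(\theta,x)=h_\theta(x)$ is assumed Borel measurable on $\Theta\times\mathcal{X}$ and continuous in $x\in\mathcal{X}$. $\mathcal{P}$ is the set of all Borel probability measures on $\Theta$. For $\mu\in\mathcal{P}$ the infinite ensemble is $h_\mu(x)=\mathbb{E}_{\theta\sim\mu}[h(\theta,x)]$, and $\mathcal{G}=\{h_\mu\mid\mu\in\mathcal{P}\}$. $\mathbb{P}_D$ is a Borel probability measure on $\mathcal{X}\times\mathcal{Y}$ (the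 true data distribution) and $(X,Y)$ denotes a random pair with values in $\mathcal{X}\times\mathcal{Y}$. $S$ is a sample of $N$ i.i.d. draws from $\mathbb{P}_D$ and $\mathbb{P}_S$ is its empirical measure. For a set $\mathcal{J}$ of bounded functions on $\mathcal{X}$ and a probability measure $m$ on $\mathcal{X}$, $N_m(\epsilon,\mathcal{J})$ is the external covering number: the minimal number of open $\|\cdot\|_{L^2(m)}$-balls of radius $\epsilon$ needed to cover $\mathcal{J}$, whose centers need not belong to $\mathcal{J}$. *)

theory Defs
  imports "HOL-Probability.Probability"
begin

definition borel_prob_measures :: "'a::topological_space set \<Rightarrow> 'a measure set" where
  "borel_prob_measures A = {M. prob_space M \<and> sets M = sets (restrict_space borel A)}"

text \<open>The base classifiers are total functions on the ambient space; only their values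
  on the parameter set and the feature space ever matter.\<close>

definition base_classifiers :: "('p \<Rightarrow> 'x \<Rightarrow> real) \<Rightarrow> 'p set \<Rightarrow> ('x \<Rightarrow> real) set" where
  "base_classifiers h \<Theta> = {h \<theta> | \<theta>. \<theta> \<in> \<Theta>}"

definition ensemble :: "('p \<Rightarrow> 'x \<Rightarrow> real) \<Rightarrow> 'p measure \<Rightarrow> 'x \<Rightarrow> real" where
  "ensemble h \<mu> x = (\<integral>\<theta>. h \<theta> x \<partial>\<mu>)"

definition ensembles ::
    "('p::topological_space \<Rightarrow> 'x \<Rightarrow> real) \<Rightarrow> 'p set \<Rightarrow> ('x \<Rightarrow> real) set" where
  "ensembles h \<Theta> = {ensemble h \<mu> | \<mu>. \<mu> \<in> borel_prob_measures \<Theta>}"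

definition L2_functions :: "'x measure \<Rightarrow> ('x \<Rightarrow> real) set" where
  "L2_functions m = {f \<in> borel_measurable m. integrable m (\<lambda>x. (f x)\<^sup>2)}"

definition L2_norm :: "'x measure \<Rightarrow> ('x \<Rightarrow> real) \<Rightarrow> real" where
  "L2_norm m f = sqrt (\<integral>x. (f x)\<^sup>2 \<partial>m)"

text \<open>Membership in \<open>L2_functions\<close> is demanded explicitly because the Bochner integral of a
  non-integrable function is \<open>0\<close>.\<close>

definition L2_ball :: "'x measure \<Rightarrow> ('x \<Rightarrow> real) \<Rightarrow> real \<Rightarrow> ('x \<Rightarrow> real) set" where
  "L2_ball m g \<epsilon> = {f \<in> L2_functions m. L2_norm m (\<lambda>x. f x - g x) < \<epsilon>}"

text \<open>External covering number: the centers range over all of \<open>L2_functions m\<close>. It is \<open>\<infinity>\<close>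
  when there is no finite cover.\<close>

definition covering_number :: "'x measure \<Rightarrow> real \<Rightarrow> ('x \<Rightarrow> real) set \<Rightarrow> enat" where
  "covering_number m \<epsilon> J =
     Inf {enat (card A) | A. finite A \<and> A \<subseteq> L2_functions m \<and> J \<subseteq> (\<Union>g\<in>A. L2_ball m g \<epsilon>)}"

text \<open>A discrete probability measure on \<open>X\<close> is a \<open>pmf\<close> whose (countable) support lies in \<open>X\<close>.\<close>

definition discrete_probs_on :: "'x set \<Rightarrow> 'x pmf set" where
  "discrete_probs_on X = {p. set_pmf p \<subseteq> X}"

definition sample_measure :: "nat \<Rightarrow> 'z measure \<Rightarrow> (nat \<Rightarrow> 'z) measure" where
  "sample_measure N D = (\<Pi>\<^sub>M i\<in>{..<N}. D)"

definition empirical_pmf :: "nat \<Rightarrow> (nat \<Rightarrow> 'z) \<Rightarrow> 'z pmf" where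
  "empirical_pmf N S = map_pmf S (pmf_of_set {..<N})"

text \<open>A uniform statement over an uncountable family need not define a measurable event, so
  ``with probability at least \<open>p\<close>'' asks for a measurable event of probability at least \<open>p\<close>
  on which the property holds. For properties that are measurable with respect to \<open>M\<close> or its
  completion this says exactly that their probability is at least \<open>p\<close>.\<close>

definition with_prob_at_least :: "'a measure \<Rightarrow> real \<Rightarrow> ('a \<Rightarrow> bool) \<Rightarrow> bool" where
  "with_prob_at_least M p P \<longleftrightarrow> (\<exists>A\<in>sets M. measure M A \<ge> p \<and> (\<forall>\<omega>\<in>A. P \<omega>))"

end

theory Submission
  imports Defs
begin

text \<open>A sample point of \<open>D\<close> enters only through the sign of \<open>y f x - \<rho>\<close>. If \<open>f\<close> is replaced by
  a point \<open>b\<close> of an \<open>L\<^sup>2\<close>-net of radius \<open>\<epsilon>\<close>, Chebyshev's inequality bounds the fraction of the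
  sample on which \<open>f\<close> and \<open>b\<close> differ by more than \<open>\<rho> / 4\<close> by \<open>16 \<epsilon>\<^sup>2 / \<rho>\<^sup>2\<close>. After symmetrization with a
  ghost sample, a union bound over the net suffices, because the factor \<open>K > 1\<close> in front of the
  empirical term allows a relative deviation inequality with exponential tails. Choosing \<open>\<epsilon>\<close> such that
  \<open>N \<epsilon>\<^sup>2 / \<rho>\<^sup>2\<close> is of the order of the log-cardinality of the net gives the stated rate, provided that the
  ensembles have \<open>L\<^sup>2\<close>-entropy of order \<open>\<epsilon> powr (- 2 V / (V + 2))\<close>.

  This sharp entropy bound for convex hulls comes from a multiscale version of Maurey's argument. A mean
  of base classifiers is split along nets of radius \<open>2 powr (- j)\<close>, and the mean of the increments at level
  \<open>j\<close> is replaced by an average of \<open>s j\<close> of them. With \<open>s j\<close> equal to \<open>2 powr (J V)\<close> times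
  \<open>8 ^ (J - j)\<close> below level \<open>J\<close> and \<open>2 powr (J - j)\<close> above it, both the errors and the log-numbers of
  multisets of increments are geometric series around \<open>J\<close>, even where \<open>s j\<close> exceeds the size of the net.

  Continuity of the ensembles on the compact feature space yields a countable uniformly dense subfamily,
  which takes care of measurability; the infimum over \<open>\<rho>\<close> is reduced to \<open>\<rho> = 2 powr (- k)\<close> with
  confidence \<open>\<delta> / 2 ^ (k + 1)\<close>.\<close>

section \<open>Means in a finite-dimensional Euclidean seminorm\<close>

text \<open>Convexity of the norm, proved by duality: pairing the mean with itself writes
  \<open>E\<^sup>2\<close> as an average of inner products, each at most \<open>E * R\<close> by
  Cauchy-Schwarz, and one factor \<open>E\<close> cancels.\<close>

lemma L2_set_expectation_le:
  fixes v :: "'t \<Rightarrow> 'i \<Rightarrow> real"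
  assumes M: "prob_space M" and fin: "finite I"
    and meas: "\<And>i. i \<in> I \<Longrightarrow> (\<lambda>t. v t i) \<in> borel_measurable M"
    and bnd: "\<And>t. t \<in> space M \<Longrightarrow> L2_set (v t) I \<le> R"
  shows "L2_set (\<lambda>i. \<integral>t. v t i \<partial>M) I \<le> R"
proof -
  interpret prob_space M by (rule M)
  define e where "e i = (\<integral>t. v t i \<partial>M)" for i
  define E where "E = L2_set e I"
  have absb: "\<bar>v t i\<bar> \<le> R" if "t \<in> space M" "i \<in> I" for t i
    using member_le_L2_set[OF fin that(2), of "\<lambda>j. \<bar>v t j\<bar>"] bnd[OF that(1)]
    by (simp add: L2_set_def)
  have int: "integrable M (\<lambda>t. v t i)" if "i \<in> I" for i
    by (rule integrable_const_bound[where B=R]) (use that absb meas in \<open>auto intro!: AE_I2\<close>)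
  have "E\<^sup>2 = (\<Sum>i\<in>I. e i * e i)"
    unfolding E_def L2_set_def by (simp add: sum_nonneg power2_eq_square)
  also have "\<dots> = expectation (\<lambda>t. \<Sum>i\<in>I. e i * v t i)"
    using int by (subst Bochner_Integration.integral_sum) (auto simp: e_def)
  also have "\<dots> \<le> expectation (\<lambda>t. E * R)"
  proof (rule integral_mono)
    fix t assume t: "t \<in> space M"
    have "(\<Sum>i\<in>I. e i * v t i) \<le> (\<Sum>i\<in>I. \<bar>e i\<bar> * \<bar>v t i\<bar>)"
      by (intro sum_mono) (metis abs_ge_self abs_mult)
    also have "\<dots> \<le> E * L2_set (v t) I" unfolding E_def by (rule L2_set_mult_ineq)
    also have "\<dots> \<le> E * R" using bnd[OF t] by (intro mult_left_mono) (auto simp: E_def)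
    finally show "(\<Sum>i\<in>I. e i * v t i) \<le> E * R" .
  qed (use int in auto)
  also have "\<dots> = E * R" by (simp add: prob_space)
  finally have *: "E * E \<le> E * R" by (simp add: power2_eq_square)
  obtain t0 where "t0 \<in> space M" using not_empty by blast
  then have R: "R \<ge> 0" using bnd[of t0] order_trans[OF L2_set_nonneg] by blast
  have "E \<ge> 0" by (simp add: E_def)
  then have "E \<le> R" using * R by (cases "E = 0") (auto simp: mult_le_cancel_left)
  then show ?thesis by (simp add: E_def e_def[abs_def])
qed

text \<open>Maurey's argument, derandomized: the points are chosen one after the other. Averaged
  over the next point, the squared deviation of the partial sum grows by at most
  \<open>R\<^sup>2\<close>, because the new summand is centered around the mean and the cross terms
  vanish; some point does no worse than the average.\<close>

lemma maurey_greedy: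
  fixes v :: "'t \<Rightarrow> 'i \<Rightarrow> real"
  assumes M: "prob_space M" and fin: "finite I"
    and meas: "\<And>i. i \<in> I \<Longrightarrow> (\<lambda>t. v t i) \<in> borel_measurable M"
    and bnd: "\<And>t. t \<in> space M \<Longrightarrow> L2_set (v t) I \<le> R"
  shows "\<exists>\<tau>. (\<forall>k<s. \<tau> k \<in> space M) \<and>
    (\<Sum>i\<in>I. ((\<Sum>k<s. v (\<tau> k) i) - real s * (\<integral>t. v t i \<partial>M))\<^sup>2) \<le> real s * R\<^sup>2"
proof (induction s)
  case 0
  then show ?case by simp
next
  case (Suc s)
  interpret prob_space M by (rule M)
  define e where "e i = (\<integral>t. v t i \<partial>M)" for i
  obtain \<tau> where \<tau>: "\<forall>k<s. \<tau> k \<in> space M"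
    "(\<Sum>i\<in>I. ((\<Sum>k<s. v (\<tau> k) i) - real s * e i)\<^sup>2) \<le> real s * R\<^sup>2"
    using Suc.IH unfolding e_def by blast
  define a where "a i = (\<Sum>k<s. v (\<tau> k) i) - real s * e i" for i
  have sumsq: "(\<Sum>i\<in>I. (v t i)\<^sup>2) \<le> R\<^sup>2" if "t \<in> space M" for t
  proof -
    have "(L2_set (v t) I)\<^sup>2 \<le> R\<^sup>2" using bnd[OF that] by (intro power_mono) auto
    then show ?thesis by (simp add: L2_set_def sum_nonneg)
  qed
  have absb: "\<bar>v t i\<bar> \<le> R" if "t \<in> space M" "i \<in> I" for t i
    using member_le_L2_set[OF fin that(2), of "\<lambda>j. \<bar>v t j\<bar>"] bnd[OF that(1)]
    by (simp add: L2_set_def)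
  have int: "integrable M (\<lambda>t. v t i)" if "i \<in> I" for i
    by (rule integrable_const_bound[where B=R]) (use that absb meas in \<open>auto intro!: AE_I2\<close>)
  have int2: "integrable M (\<lambda>t. (v t i)\<^sup>2)" if "i \<in> I" for i
    by (rule integrable_const_bound[where B="R\<^sup>2"])
      (use that absb meas in \<open>auto intro!: AE_I2 simp: abs_le_square_iff[symmetric] intro: order_trans[OF _ abs_ge_self]\<close>)
  define g where "g t = (\<Sum>i\<in>I. (a i + v t i - e i)\<^sup>2)" for t
  have g_eq: "g t = (\<Sum>i\<in>I. (a i - e i)\<^sup>2 + 2 * (a i - e i) * v t i + (v t i)\<^sup>2)" for t
    unfolding g_def by (intro sum.cong refl) (simp add: power2_eq_square algebra_simps)
  have intg: "integrable M g"
    unfolding g_eq[abs_def] using int int2 by (intro Bochner_Integration.integrable_sum Bochner_Integration.integrable_add integrable_mult_right) auto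
  have "expectation g = (\<Sum>i\<in>I. (a i - e i)\<^sup>2 + 2 * (a i - e i) * e i + expectation (\<lambda>t. (v t i)\<^sup>2))"
    unfolding g_eq[abs_def] using int int2
    by (subst Bochner_Integration.integral_sum) (auto simp: e_def prob_space intro!: sum.cong)
  \<comment> \<open>The first two terms of each summand add up to
    \<open>(a i)\<^sup>2 - (e i)\<^sup>2\<close>, so nothing linear in \<open>a\<close>
    survives.\<close>
  also have "\<dots> \<le> (\<Sum>i\<in>I. (a i)\<^sup>2) + (\<Sum>i\<in>I. expectation (\<lambda>t. (v t i)\<^sup>2))"
    unfolding sum.distrib[symmetric] by (intro sum_mono) (simp add: power2_eq_square algebra_simps)
  also have "(\<Sum>i\<in>I. expectation (\<lambda>t. (v t i)\<^sup>2)) = expectation (\<lambda>t. \<Sum>i\<in>I. (v t i)\<^sup>2)"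
    using int2 by (subst Bochner_Integration.integral_sum) auto
  also have "\<dots> \<le> expectation (\<lambda>t. R\<^sup>2)"
    using int2 sumsq by (intro integral_mono) auto
  also have "\<dots> = R\<^sup>2" by (simp add: prob_space)
  finally have eg: "expectation g \<le> real (Suc s) * R\<^sup>2"
    using \<tau>(2) unfolding a_def[symmetric] by (simp add: algebra_simps)
  obtain t where t: "t \<in> space M" "g t \<le> real (Suc s) * R\<^sup>2"
  proof (rule ccontr)
    assume "\<not> thesis"
    then have "AE t in M. real (Suc s) * R\<^sup>2 < g t"
      using that by (intro AE_I2) force
    from expectation_greater[OF intg this] eg show False by simp
  qed
  have "(\<Sum>i\<in>I. ((\<Sum>k<Suc s. v ((\<tau>(s := t)) k) i) - real (Suc s) * e i)\<^sup>2) = g t"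
    unfolding g_def a_def by (intro sum.cong refl) (simp add: algebra_simps)
  then show ?case
    using t \<tau>(1) unfolding e_def[symmetric] by (intro exI[of _ "\<tau>(s := t)"]) (auto simp: less_Suc_eq)
qed

lemma maurey:
  fixes v :: "'t \<Rightarrow> 'i \<Rightarrow> real"
  assumes M: "prob_space M" and fin: "finite I"
    and meas: "\<And>i. i \<in> I \<Longrightarrow> (\<lambda>t. v t i) \<in> borel_measurable M"
    and bnd: "\<And>t. t \<in> space M \<Longrightarrow> L2_set (v t) I \<le> R"
    and s: "s > 0"
  shows "\<exists>\<tau>. (\<forall>k<s. \<tau> k \<in> space M) \<and>
    L2_set (\<lambda>i. (\<integral>t. v t i \<partial>M) - (\<Sum>k<s. v (\<tau> k) i) / real s) I \<le> R / sqrt (real s)"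
proof -
  interpret prob_space M by (rule M)
  obtain t0 where "t0 \<in> space M" using not_empty by blast
  then have R: "R \<ge> 0" using bnd[of t0] order_trans[OF L2_set_nonneg] by blast
  obtain \<tau> where \<tau>: "\<forall>k<s. \<tau> k \<in> space M"
    "(\<Sum>i\<in>I. ((\<Sum>k<s. v (\<tau> k) i) - real s * (\<integral>t. v t i \<partial>M))\<^sup>2) \<le> real s * R\<^sup>2"
    using maurey_greedy[OF M fin meas bnd] by blast
  have "(\<Sum>i\<in>I. ((\<integral>t. v t i \<partial>M) - (\<Sum>k<s. v (\<tau> k) i) / real s)\<^sup>2) =
     (\<Sum>i\<in>I. ((\<Sum>k<s. v (\<tau> k) i) - real s * (\<integral>t. v t i \<partial>M))\<^sup>2) / (real s)\<^sup>2"
  proof -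
    have "(e - S / real s)\<^sup>2 = (S - real s * e)\<^sup>2 / (real s)\<^sup>2" for e S :: real
      using s by (subst power_divide[symmetric], subst power2_commute) (simp add: diff_divide_distrib)
    then show ?thesis by (simp only: sum_divide_distrib[symmetric])
  qed
  also have "\<dots> \<le> real s * R\<^sup>2 / (real s)\<^sup>2" using \<tau>(2) by (intro divide_right_mono) auto
  also have "\<dots> = (R / sqrt (real s))\<^sup>2" using s by (simp add: power_divide power2_eq_square)
  finally have "L2_set (\<lambda>i. (\<integral>t. v t i \<partial>M) - (\<Sum>k<s. v (\<tau> k) i) / real s) I \<le> R / sqrt (real s)"
    unfolding L2_set_def using R by (intro real_le_lsqrt) auto
  then show ?thesis using \<tau>(1) by blast
qed

text \<open>A single term of the binomial expansion of \<open>(p + q) ^ (s + m) = 1\<close> is at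
  most 1. The choice \<open>p = S / (S + T)\<close> makes the bound symmetric, so that it stays
  useful whichever of \<open>S\<close> and \<open>T\<close> is the larger. Real upper bounds may
  replace \<open>s\<close> and \<open>m\<close> because \<open>ln p\<close> and \<open>ln q\<close>
  are not positive.\<close>

lemma ln_binomial_le:
  fixes S T :: real
  assumes "0 < S" "0 < T" "real s \<le> S" "real m \<le> T"
  shows "ln (real ((s + m) choose s)) \<le> S * ln (1 + T / S) + T * ln (1 + S / T)"
proof -
  define p q where "p = S / (S + T)" and "q = T / (S + T)"
  have pq: "p > 0" "q > 0" "p + q = 1" "p \<le> 1" "q \<le> 1"
    using assms by (auto simp: p_def q_def add_divide_distrib[symmetric])
  have "real ((s + m) choose s) * p ^ s * q ^ (s + m - s) \<le>
      (\<Sum>k\<le>s + m. real ((s + m) choose k) * p ^ k * q ^ (s + m - k))"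
    using pq by (intro member_le_sum[of s]) auto
  also have "\<dots> = 1" using binomial_ring[of p q "s + m"] pq by simp
  finally have le: "real ((s + m) choose s) * p ^ s * q ^ m \<le> 1" by simp
  have pos: "real ((s + m) choose s) > 0" by (simp add: zero_less_binomial_iff)
  have "ln (real ((s + m) choose s)) + real s * ln p + real m * ln q \<le> 0"
  proof -
    have "ln (real ((s + m) choose s) * p ^ s * q ^ m) \<le> 0"
      using le pos pq by (subst ln_le_zero_iff) auto
    then show ?thesis using pos pq by (simp add: ln_mult ln_realpow)
  qed
  moreover have "real s * ln p \<ge> S * ln p" "real m * ln q \<ge> T * ln q"
    using assms pq by (auto intro!: mult_right_mono_neg)
  moreover have "ln p = - ln (1 + T / S)" "ln q = - ln (1 + S / T)"
    using assms unfolding p_def q_def by (auto simp: ln_div[symmetric] field_simps ln_div)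
  ultimately show ?thesis by simp
qed


section \<open>Finite covers for means\<close>

lemma integrable_pmf_finite_values:
  fixes w :: "'t \<Rightarrow> 'i \<Rightarrow> real"
  assumes "finite H" "\<And>t. w t \<in> H"
  shows "integrable (measure_pmf q) (\<lambda>t. w t i)"
proof -
  have "\<bar>w t i\<bar> \<le> (\<Sum>g\<in>H. \<bar>g i\<bar>)" for t
    using assms by (intro member_le_sum[of "w t" H "\<lambda>g. \<bar>g i\<bar>"]) auto
  then show ?thesis
    by (intro measure_pmf.integrable_const_bound[where B="\<Sum>g\<in>H. \<bar>g i\<bar>"]) auto
qed

text \<open>By \<open>maurey\<close>, averages of \<open>s\<close> members of \<open>G\<close>
  approximate every mean. An average depends only on the multiset of its members; counting multisets
  instead of sequences keeps the entropy at \<open>T\<close> up to a logarithm even if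
  \<open>S\<close> is far larger than \<open>T\<close>. The factor 2 in the error absorbs the
  rounding of \<open>S\<close> down to \<open>s\<close>.\<close>

lemma means_cover_finite:
  fixes G :: "('i \<Rightarrow> real) set"
  assumes I: "finite I" and G: "finite G" and R: "\<And>g. g \<in> G \<Longrightarrow> L2_set g I \<le> R"
    and T: "real (card G) \<le> T" "T > 0" and S: "S > 0"
  shows "\<exists>B. finite B \<and> real (card B) \<le> exp (S * ln (1 + T / S) + T * ln (1 + S / T)) \<and>
    (\<forall>(q::'t pmf) w. (\<forall>t. w t \<in> G) \<longrightarrow>
      (\<exists>b\<in>B. L2_set (\<lambda>i. measure_pmf.expectation q (\<lambda>t. w t i) - b i) I \<le> 2 * R / sqrt S))"
proof -
  define s where "s = nat \<lfloor>S\<rfloor>"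
  have sS: "real s \<le> S" using S by (simp add: s_def)
  define B where "B = (\<lambda>X i. (\<Sum>g\<in>#X. g i) / real s) ` multisets_of_size G s"
  have finB: "finite B" unfolding B_def using G by (intro finite_imageI) auto
  have "card B \<le> card (multisets_of_size G s)"
    unfolding B_def using G by (intro card_image_le) auto
  also have "\<dots> = (card G + s - 1) choose s" using G by (rule card_multisets_of_size)
  also have "\<dots> \<le> (s + card G) choose s" by (intro binomial_right_mono) auto
  finally have "real (card B) \<le> real ((s + card G) choose s)" by simp
  also have "\<dots> = exp (ln (real ((s + card G) choose s)))"
    by (subst exp_ln) (simp_all add: zero_less_binomial_iff)
  also have "\<dots> \<le> exp (S * ln (1 + T / S) + T * ln (1 + S / T))"
    by (rule exp_mono[OF ln_binomial_le[OF S T(2) sS T(1)]])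
  finally have cardB: "real (card B) \<le> exp (S * ln (1 + T / S) + T * ln (1 + S / T))" .
  have "\<exists>b\<in>B. L2_set (\<lambda>i. measure_pmf.expectation q (\<lambda>t. w t i) - b i) I \<le> 2 * R / sqrt S"
    if w: "\<And>t. w t \<in> G" for q :: "'t pmf" and w
  proof -
    have P: "prob_space (measure_pmf q)" by unfold_locales
    have R0: "R \<ge> 0" using R[OF w] order_trans[OF L2_set_nonneg] by blast
    show ?thesis
    \<comment> \<open>For \<open>s = 0\<close> the only multiset is empty, and
      \<open>0 / 0 = 0\<close> makes its average the zero function. Its error is at most
      \<open>R\<close>, which suffices because \<open>S \<le> 1\<close>.\<close>
    proof (cases "s = 0")
      case True
      then have S1: "S \<le> 1" using S unfolding s_def by linarith
      have "L2_set (\<lambda>i. measure_pmf.expectation q (\<lambda>t. w t i)) I \<le> R"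
        using R[OF w] by (intro L2_set_expectation_le[OF P I]) auto
      also have "\<dots> \<le> 2 * R / sqrt S"
        using S S1 R0 mult_left_mono[of "sqrt S" 2 R] by (simp add: field_simps order_trans[of _ 1])
      finally show ?thesis
        using True by (auto simp: B_def multisets_of_size_def intro!: bexI[of _ "{#}"])
    next
      case False
      obtain \<tau> where \<tau>: "L2_set (\<lambda>i. measure_pmf.expectation q (\<lambda>t. w t i) -
          (\<Sum>k<s. w (\<tau> k) i) / real s) I \<le> R / sqrt (real s)"
        using maurey[OF P I, of w R s] R[OF w] False by auto
      have "S \<le> 2 * real s" using False S unfolding s_def by linarith
      then have "sqrt S \<le> 2 * sqrt (real s)"
        using real_sqrt_le_mono[of S "4 * real s"] by (simp add: real_sqrt_mult)
      then have "R / sqrt (real s) \<le> 2 * R / sqrt S"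
        using S False R0 mult_left_mono[of "sqrt S" "2 * sqrt (real s)" R] by (simp add: field_simps)
      moreover have "(\<lambda>i. (\<Sum>k<s. w (\<tau> k) i) / real s) \<in> B"
        unfolding B_def
        by (rule image_eqI[of _ _ "image_mset (\<lambda>k. w (\<tau> k)) (mset_set {..<s})"])
          (use w in \<open>auto simp: multisets_of_size_def sum_unfold_sum_mset image_mset.compositionality o_def\<close>)
      ultimately show ?thesis using \<tau> by (intro bexI) auto
    qed
  qed
  then show ?thesis using finB cardB by blast
qed

text \<open>Telescoping along \<open>f \<mapsto> \<pi> n f\<close>: as every level is projected to the next coarser one,
  the increments at level \<open>n\<close> are indexed by \<open>H (Suc n)\<close> alone, and not by pairs of net points.\<close>

lemma means_cover_chain:
  fixes H :: "nat \<Rightarrow> ('i \<Rightarrow> real) set" and \<pi> :: "nat \<Rightarrow> ('i \<Rightarrow> real) \<Rightarrow> 'i \<Rightarrow> real"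
  assumes I: "finite I" and H0: "H 0 = {\<lambda>_. 0}"
    and fin: "\<And>j. finite (H (Suc j))" and card: "\<And>j. real (card (H (Suc j))) \<le> T j"
    and T: "\<And>j. T j > 0" and S: "\<And>j. S j > 0"
    and \<pi>: "\<And>j f. f \<in> H (Suc j) \<Longrightarrow> \<pi> j f \<in> H j"
    and R: "\<And>j f. f \<in> H (Suc j) \<Longrightarrow> L2_set (\<lambda>i. f i - \<pi> j f i) I \<le> R j"
  shows "\<exists>B. finite B \<and>
    real (card B) \<le> exp (\<Sum>j<n. S j * ln (1 + T j / S j) + T j * ln (1 + S j / T j)) \<and>
    (\<forall>(q::'t pmf) w. (\<forall>t. w t \<in> H n) \<longrightarrow>
      (\<exists>b\<in>B. L2_set (\<lambda>i. measure_pmf.expectation q (\<lambda>t. w t i) - b i) I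
         \<le> (\<Sum>j<n. 2 * R j / sqrt (S j))))"
proof (induction n)
  case 0
  then show ?case by (intro exI[of _ "{\<lambda>_. 0}"]) (auto simp: H0 L2_set_def)
next
  case (Suc n)
  obtain B1 where B1: "finite B1"
    "real (card B1) \<le> exp (\<Sum>j<n. S j * ln (1 + T j / S j) + T j * ln (1 + S j / T j))"
    "\<And>(q::'t pmf) w. (\<And>t. w t \<in> H n) \<Longrightarrow>
      (\<exists>b\<in>B1. L2_set (\<lambda>i. measure_pmf.expectation q (\<lambda>t. w t i) - b i) I
         \<le> (\<Sum>j<n. 2 * R j / sqrt (S j)))"
    using Suc.IH by blast
  define G where "G = (\<lambda>g i. g i - \<pi> n g i) ` H (Suc n)"
  have G: "finite G" "\<And>g. g \<in> G \<Longrightarrow> L2_set g I \<le> R n"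
    using fin R by (auto simp: G_def)
  have "card G \<le> card (H (Suc n))" unfolding G_def using fin by (rule card_image_le)
  then have cG: "real (card G) \<le> T n" using card[of n] by linarith
  obtain B2 where B2: "finite B2"
    "real (card B2) \<le> exp (S n * ln (1 + T n / S n) + T n * ln (1 + S n / T n))"
    "\<And>(q::'t pmf) w. (\<And>t. w t \<in> G) \<Longrightarrow>
      (\<exists>b\<in>B2. L2_set (\<lambda>i. measure_pmf.expectation q (\<lambda>t. w t i) - b i) I \<le> 2 * R n / sqrt (S n))"
    using means_cover_finite[where ?'t='t, OF I G cG T S[of n]] by blast
  \<comment> \<open>One summand approximates the mean of the projections, the other the mean of the
    increments. The sizes of the two nets multiply, so the exponents add up along the chain.\<close>
  define B where "B = (\<lambda>(b1, b2) i. b1 i + b2 i) ` (B1 \<times> B2)"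
  have "card B \<le> card (B1 \<times> B2)" unfolding B_def using B1(1) B2(1) by (intro card_image_le) auto
  then have "real (card B) \<le> real (card B1) * real (card B2)"
    by (simp add: card_cartesian_product flip: of_nat_mult)
  also have "\<dots> \<le> exp (\<Sum>j<Suc n. S j * ln (1 + T j / S j) + T j * ln (1 + S j / T j))"
    using mult_mono[OF B1(2) B2(2)] by (simp add: exp_add)
  finally have cB: "real (card B) \<le> exp (\<Sum>j<Suc n. S j * ln (1 + T j / S j) + T j * ln (1 + S j / T j))" .
  have "\<exists>b\<in>B. L2_set (\<lambda>i. measure_pmf.expectation q (\<lambda>t. w t i) - b i) I
         \<le> (\<Sum>j<Suc n. 2 * R j / sqrt (S j))"
    if w: "\<And>t. w t \<in> H (Suc n)" for q :: "'t pmf" and w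
  proof -
    have wH: "\<And>t. \<pi> n (w t) \<in> H n" using \<pi> w by blast
    have wG: "\<And>t. (\<lambda>i. w t i - \<pi> n (w t) i) \<in> G" using w by (auto simp: G_def)
    have finHn: "finite (H n)" by (cases n) (auto simp: H0 fin)
    obtain b1 where b1: "b1 \<in> B1" "L2_set (\<lambda>i. measure_pmf.expectation q (\<lambda>t. \<pi> n (w t) i) - b1 i) I
         \<le> (\<Sum>j<n. 2 * R j / sqrt (S j))"
      using B1(3)[where w="\<lambda>t. \<pi> n (w t)" and q=q, OF wH] by blast
    obtain b2 where b2: "b2 \<in> B2" "L2_set (\<lambda>i. measure_pmf.expectation q (\<lambda>t. w t i - \<pi> n (w t) i) - b2 i) I
         \<le> 2 * R n / sqrt (S n)"
      using B2(3)[where w="\<lambda>t i. w t i - \<pi> n (w t) i" and q=q, OF wG] by blast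
    have eq: "measure_pmf.expectation q (\<lambda>t. w t i - \<pi> n (w t) i) =
        measure_pmf.expectation q (\<lambda>t. w t i) - measure_pmf.expectation q (\<lambda>t. \<pi> n (w t) i)" for i
      by (intro Bochner_Integration.integral_diff integrable_pmf_finite_values[OF fin w]
          integrable_pmf_finite_values[OF finHn wH])
    have "L2_set (\<lambda>i. measure_pmf.expectation q (\<lambda>t. w t i) - (b1 i + b2 i)) I \<le>
       L2_set (\<lambda>i. measure_pmf.expectation q (\<lambda>t. \<pi> n (w t) i) - b1 i) I +
       L2_set (\<lambda>i. measure_pmf.expectation q (\<lambda>t. w t i - \<pi> n (w t) i) - b2 i) I"
      by (rule order_trans[OF _ L2_set_triangle_ineq]) (simp add: eq algebra_simps)
    then have "L2_set (\<lambda>i. measure_pmf.expectation q (\<lambda>t. w t i) - (b1 i + b2 i)) I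
         \<le> (\<Sum>j<Suc n. 2 * R j / sqrt (S j))"
      using b1(2) b2(2) by simp
    moreover have "(\<lambda>i. b1 i + b2 i) \<in> B" using b1(1) b2(1) by (auto simp: B_def)
    ultimately show ?thesis by (rule bexI)
  qed
  moreover have "finite B" unfolding B_def using B1(1) B2(1) by auto
  ultimately show ?case using cB by blast
qed

section \<open>Entropy of convex hulls\<close>

text \<open>This is the absolute value of \<open>j - J\<close>; the case split keeps the subtraction
  of natural numbers from truncating.\<close>

definition ndist :: "nat \<Rightarrow> nat \<Rightarrow> nat" where
  "ndist J j = (if j \<le> J then J - j else j - J)"

text \<open>Every distance occurs at most once among the levels up to \<open>J\<close> and at most
  once among those above \<open>J\<close>.\<close>

lemma sum_ndist_le:
  fixes g :: "nat \<Rightarrow> real"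
  assumes g: "summable g" and nn: "\<And>d. 0 \<le> g d"
  shows "(\<Sum>j<m. g (ndist J j)) \<le> 2 * suminf g"
proof -
  have 1: "(\<Sum>j\<in>{..<m} \<inter> {..J}. g (ndist J j)) \<le> suminf g"
  proof -
    have "(\<Sum>j\<in>{..<m} \<inter> {..J}. g (ndist J j)) = sum g ((\<lambda>j. J - j) ` ({..<m} \<inter> {..J}))"
      by (subst sum.reindex) (auto simp: inj_on_def ndist_def intro!: sum.cong)
    also have "\<dots> \<le> suminf g" using g nn by (intro sum_le_suminf) auto
    finally show ?thesis .
  qed
  have 2: "(\<Sum>j\<in>{..<m} - {..J}. g (ndist J j)) \<le> suminf g"
  proof -
    have "(\<Sum>j\<in>{..<m} - {..J}. g (ndist J j)) = sum g ((\<lambda>j. j - J) ` ({..<m} - {..J}))"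
      by (subst sum.reindex) (auto simp: inj_on_def ndist_def intro!: sum.cong)
    also have "\<dots> \<le> suminf g" using g nn by (intro sum_le_suminf) auto
    finally show ?thesis .
  qed
  have "(\<Sum>j<m. g (ndist J j)) =
      (\<Sum>j\<in>{..<m} \<inter> {..J}. g (ndist J j)) + (\<Sum>j\<in>{..<m} - {..J}. g (ndist J j))"
    by (rule sum.Int_Diff) auto
  then show ?thesis using 1 2 by linarith
qed

text \<open>Put \<open>d = ndist J j\<close>. By \<open>ln (1 + x) \<le> x\<close>, one of the two
  summands is at most \<open>T\<close> below \<open>J\<close> and at most \<open>S\<close> above it.
  The other is the same quantity times a logarithm that is linear in \<open>d\<close>, since
  \<open>S / T\<close> and \<open>T / S\<close> are then at most exponential in \<open>d\<close>.
  Relative to \<open>2 powr (real J * V)\<close>, \<open>T\<close> decays like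
  \<open>2 powr (- V * d)\<close> below \<open>J\<close>, and \<open>S\<close> like
  \<open>2 powr (- d)\<close> above it; \<open>q\<close> is the worse of the two ratios.\<close>

lemma level_entropy_le:
  fixes J j :: nat and C V :: real
  assumes C: "C \<ge> 1" and V: "V > 0"
  defines "S \<equiv> 2 powr (real J * V) * (if j \<le> J then 8 ^ (J - j) else (1/2) ^ (j - J))"
    and "T \<equiv> C * 2 powr (real j * V)"
    and "q \<equiv> max (1/2) (2 powr (- V))"
    and "K \<equiv> C * (2 + ln (1 + C) + (V + 3))"
  shows "S * ln (1 + T / S) + T * ln (1 + S / T)
    \<le> 2 powr (real J * V) * (K * ((real (ndist J j) + 1) * q ^ ndist J j))"
proof -
  define n where "n = 2 powr (real J * V)"
  have n: "n > 0" by (simp add: n_def)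
  have ln2: "ln (2::real) \<le> 1" "0 < ln (2::real)" using ln_le_minus_one[of 2] by auto
  have lnC: "ln (1 + C) \<ge> 0" using C by simp
  have ST: "S > 0" "T > 0" using C by (auto simp: S_def T_def)
  have ln_le: "x * ln (1 + y / x) \<le> y" if "x > 0" "y > 0" for x y :: real
    using ln_add_one_self_le_self[of "y / x"] mult_left_mono[of "ln (1 + y / x)" "y / x" x] that by simp
  have K0: "C * (2 + ln (1 + C) + (V + 3)) \<ge> 0" using C V lnC by simp
  show ?thesis
  proof (cases "j \<le> J")
    case True
    define d where "d = J - j"
    have d: "real j = real J - real d" "ndist J j = d" using True by (auto simp: d_def ndist_def)
    have "(8::real) ^ d = 2 powr (3 * real d)"
      by (simp add: powr_realpow[symmetric] powr_powr[symmetric] powr_numeral)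
    then have S: "S = n * 2 powr (3 * real d)"
      using True by (simp add: S_def n_def d_def)
    have T': "T = C * n * 2 powr (- V * real d)"
      by (simp add: T_def n_def d powr_add[symmetric] algebra_simps)
    have T: "T = C * n * (2 powr (- V)) ^ d"
      by (simp add: T' powr_realpow[symmetric] powr_powr)
    have "S / T = 2 powr (3 * real d + V * real d) / C"
      using n C unfolding S T' powr_add by (simp add: powr_minus field_simps)
    also have "\<dots> \<le> 2 powr (3 * real d + V * real d)"
      using C by (simp add: divide_le_eq mult_left_mono[of 1 C, simplified])
    finally have "1 + S / T \<le> 1 + 2 powr (3 * real d + V * real d)" by simp
    also have "\<dots> \<le> 2 * 2 powr (3 * real d + V * real d)" using V by (simp add: ge_one_powr_ge_zero)
    finally have "ln (1 + S / T) \<le> ln (2 * 2 powr (3 * real d + V * real d))"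
      using ST by (intro ln_mono) (auto intro: add_pos_pos)
    also have "\<dots> = ln 2 + (3 * real d + V * real d) * ln 2" by (simp add: ln_mult ln_powr)
    also have "\<dots> \<le> 1 + (3 * real d + V * real d) * 1"
      using ln2 V by (intro add_mono mult_left_mono) auto
    finally have l: "ln (1 + S / T) \<le> 1 + (3 + V) * real d" by (simp add: algebra_simps)
    have "S * ln (1 + T / S) + T * ln (1 + S / T) \<le> T + T * (1 + (3 + V) * real d)"
      using ln_le[OF ST] l ST by (intro add_mono mult_left_mono) auto
    also have "\<dots> = T * (2 + (3 + V) * real d)" by (simp add: algebra_simps)
    also have "\<dots> \<le> T * ((2 + ln (1 + C) + (V + 3)) * (real d + 1))"
    proof -
      have "0 \<le> real d * 2" "0 \<le> ln (1 + C) * real d" using lnC by auto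
      then have "2 + (3 + V) * real d \<le> (2 + ln (1 + C) + (V + 3)) * (real d + 1)"
        using V lnC by (simp add: algebra_simps)
      then show ?thesis using ST by (intro mult_left_mono) auto
    qed
    also have "\<dots> = n * (K * ((real d + 1) * (2 powr (- V)) ^ d))" by (simp add: T K_def)
    also have "\<dots> \<le> n * (K * ((real d + 1) * q ^ d))"
      using n K0 unfolding K_def q_def by (intro mult_left_mono power_mono) auto
    finally show ?thesis by (simp add: d n_def)
  next
    case False
    define d where "d = j - J"
    have d: "real j = real J + real d" "ndist J j = d" using False by (auto simp: d_def ndist_def)
    have S: "S = n * (1/2) ^ d" using False by (simp add: S_def n_def d_def)
    have S': "S = n * 2 powr (- real d)"
      by (simp add: S powr_minus_divide powr_realpow power_one_over)
    have T: "T = C * n * 2 powr (V * real d)"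
      by (simp add: T_def n_def d powr_add[symmetric] algebra_simps)
    have "1 + T / S = 1 + C * 2 powr ((V + 1) * real d)"
      using n unfolding S' T by (simp add: powr_minus field_simps powr_add)
    also have "\<dots> \<le> (1 + C) * 2 powr ((V + 1) * real d)"
      using V by (simp add: ge_one_powr_ge_zero algebra_simps)
    finally have "ln (1 + T / S) \<le> ln ((1 + C) * 2 powr ((V + 1) * real d))"
      using ST by (intro ln_mono) (auto intro: add_pos_pos)
    also have "\<dots> = ln (1 + C) + ((V + 1) * real d) * ln 2" using C by (simp add: ln_mult ln_powr)
    also have "\<dots> \<le> ln (1 + C) + ((V + 1) * real d) * 1"
      using ln2 V by (intro add_mono mult_left_mono) auto
    finally have l: "ln (1 + T / S) \<le> ln (1 + C) + (V + 1) * real d" by simp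
    have "S * ln (1 + T / S) + T * ln (1 + S / T) \<le> S * (ln (1 + C) + (V + 1) * real d) + S"
      using ln_le[of T S] l ST by (intro add_mono mult_left_mono) auto
    also have "\<dots> = S * (1 + ln (1 + C) + (V + 1) * real d)" by (simp add: algebra_simps)
    also have "\<dots> \<le> S * ((2 + ln (1 + C) + (V + 3)) * (real d + 1))"
    proof -
      have "0 \<le> real d" "0 \<le> ln (1 + C) * real d" using lnC by auto
      then have "1 + ln (1 + C) + (V + 1) * real d \<le> (2 + ln (1 + C) + (V + 3)) * (real d + 1)"
        using V lnC by (simp add: algebra_simps)
      then show ?thesis using ST by (intro mult_left_mono) auto
    qed
    also have "\<dots> \<le> S * (K * (real d + 1))"
    proof -
      have "1 * (2 + ln (1 + C) + (V + 3)) \<le> K"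
        unfolding K_def using C V lnC by (intro mult_right_mono) auto
      then show ?thesis using ST by (intro mult_left_mono mult_right_mono) auto
    qed
    also have "\<dots> = n * (K * ((real d + 1) * (1/2) ^ d))" by (simp add: S)
    also have "\<dots> \<le> n * (K * ((real d + 1) * q ^ d))"
      using n K0 unfolding K_def q_def by (intro mult_left_mono power_mono) auto
    finally show ?thesis by (simp add: d n_def)
  qed
qed

text \<open>The bases 8 and \<open>1/2\<close> in \<open>S\<close> are chosen for this: at distance
  \<open>d\<close> below \<open>J\<close> the radius gains \<open>2 ^ d\<close> while
  \<open>sqrt S\<close> gains \<open>2 powr (3 * d / 2)\<close>; above \<open>J\<close> the radius
  loses \<open>2 ^ d\<close> while \<open>sqrt S\<close> loses only \<open>2 powr (d / 2)\<close>.
  Both sides decay like \<open>2 powr (- d / 2)\<close>.\<close>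

lemma level_error_eq:
  fixes J j :: nat and V \<rho> :: real
  defines "S \<equiv> 2 powr (real J * V) * (if j \<le> J then 8 ^ (J - j) else (1/2) ^ (j - J))"
  shows "2 * (2 * (1/2) ^ j * \<rho>) / sqrt S = 4 * \<rho> * 2 powr (- real J * (1 + V / 2)) * (1 / sqrt 2) ^ ndist J j"
proof -
  have s2: "1 / sqrt 2 = 2 powr (- (1/2))" by (simp add: powr_minus_divide powr_half_sqrt)
  have half: "(1/2::real) ^ k = 2 powr (- real k)" for k
    by (simp add: powr_minus_divide powr_realpow power_one_over)
  have eight: "(8::real) ^ k = 2 powr (3 * real k)" for k
    by (simp add: powr_realpow[symmetric] powr_powr[symmetric] powr_numeral)
  show ?thesis
  proof (cases "j \<le> J")
    case True
    define d where "d = J - j"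
    have d: "real j = real J - real d" "ndist J j = d" "S = 2 powr (real J * V + 3 * real d)"
      using True by (auto simp: d_def ndist_def S_def eight powr_add)
    show ?thesis
      unfolding d(2,3) half d(1) s2
      by (simp add: powr_half_sqrt[symmetric] powr_powr powr_realpow[symmetric] divide_powr_uminus
          flip: powr_add) (simp add: field_simps flip: powr_add,
        (intro disjI2 arg_cong[where f="\<lambda>x. 2 powr x"], simp add: field_simps)?)
  next
    case False
    define d where "d = j - J"
    have d: "real j = real J + real d" "ndist J j = d" "S = 2 powr (real J * V - real d)"
      using False by (auto simp: d_def ndist_def S_def half powr_add[symmetric] algebra_simps)
    show ?thesis
      unfolding d(2,3) half d(1) s2
      by (simp add: powr_half_sqrt[symmetric] powr_powr powr_realpow[symmetric] divide_powr_uminus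
          flip: powr_add) (simp add: field_simps flip: powr_add,
        (intro disjI2 arg_cong[where f="\<lambda>x. 2 powr x"], simp add: field_simps)?)
  qed
qed


section \<open>Summation over all levels of the chain\<close>

lemma summable_Suc_geometric:
  fixes q :: real
  assumes "0 \<le> q" "q < 1"
  shows "summable (\<lambda>d. (real d + 1) * q ^ d)"
  using geometric_deriv_sums[of q] assms by (auto simp: sums_iff add.commute)

text \<open>The chain is run up to a level \<open>m\<close> at which the unresolved remainder is
  below the target accuracy. Entropies and errors of the levels are dominated by convergent series
  in the distance to \<open>J\<close>, so \<open>K1\<close> and \<open>K2\<close> depend neither on
  \<open>m\<close> nor on \<open>J\<close>, \<open>I\<close>, \<open>H\<close> and
  \<open>\<rho>\<close>.\<close>

lemma means_cover_entropy:
  fixes C V :: real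
  assumes C: "C \<ge> 1" and V: "V > 0"
  obtains K1 K2 where "K1 > 0" "K2 > 0"
    "\<And>(I::'i set) (H::('i \<Rightarrow> real) set) \<rho> J.
      finite I \<Longrightarrow> \<rho> \<ge> 0 \<Longrightarrow> (\<And>f. f \<in> H \<Longrightarrow> L2_set f I \<le> \<rho>) \<Longrightarrow>
      (\<And>j::nat. j > 0 \<Longrightarrow> \<exists>A. finite A \<and> real (card A) \<le> C * 2 powr (real j * V) \<and>
        (\<forall>f\<in>H. \<exists>a\<in>A. L2_set (\<lambda>i. f i - a i) I \<le> (1/2) ^ j * \<rho>)) \<Longrightarrow>
      \<exists>B. finite B \<and> real (card B) \<le> exp (K1 * 2 powr (real J * V)) \<and>
        (\<forall>(q::'t pmf) w. (\<forall>t. w t \<in> H) \<longrightarrow>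
          (\<exists>b\<in>B. L2_set (\<lambda>i. measure_pmf.expectation q (\<lambda>t. w t i) - b i) I
            \<le> K2 * 2 powr (- real J * (1 + V / 2)) * \<rho>))"
proof -
  \<comment> \<open>The net for index \<open>j\<close> is taken at scale \<open>Suc j\<close>; the
    additional factor \<open>2 powr V\<close> in its size is absorbed here.\<close>
  define C' where "C' = C * 2 powr V"
  have "1 * 1 \<le> C * 2 powr V" using C V by (intro mult_mono) (auto simp: ge_one_powr_ge_zero)
  then have C': "C' \<ge> 1" by (simp add: C'_def)
  define q0 where "q0 = max (1/2) (2 powr (- V))"
  have q0: "0 \<le> q0" "q0 < 1" using V powr_less_one[of 2 "- V"] by (auto simp: q0_def)
  define L where "L = C' * (2 + ln (1 + C') + (V + 3))"
  have L: "L > 0" unfolding L_def using C' V by (intro mult_pos_pos add_pos_pos add_pos_nonneg) auto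
  define g1 g2 where "g1 d = (real d + 1) * q0 ^ d" and "g2 d = (1 / sqrt 2) ^ d" for d :: nat
  have g1: "summable g1" "\<And>d. 0 \<le> g1 d"
    unfolding g1_def using summable_Suc_geometric[OF q0] q0 by auto
  have g2: "summable g2" "\<And>d. 0 \<le> g2 d"
    unfolding g2_def by (auto intro!: summable_geometric)
  define K1 K2 where "K1 = L * (2 * suminf g1) + 1" and "K2 = 4 * (2 * suminf g2) + 1"
  have K: "K1 > 0" "K2 > 0"
    using suminf_nonneg[OF g1] suminf_nonneg[OF g2] L by (auto simp: K1_def K2_def intro!: add_nonneg_pos)
  have main: "\<exists>B. finite B \<and> real (card B) \<le> exp (K1 * 2 powr (real J * V)) \<and>
        (\<forall>(q::'t pmf) w. (\<forall>t. w t \<in> H) \<longrightarrow>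
          (\<exists>b\<in>B. L2_set (\<lambda>i. measure_pmf.expectation q (\<lambda>t. w t i) - b i) I
            \<le> K2 * 2 powr (- real J * (1 + V / 2)) * \<rho>))"
    if I: "finite I" and \<rho>: "\<rho> \<ge> 0" and bnd: "\<And>f. f \<in> H \<Longrightarrow> L2_set f I \<le> \<rho>"
      and nets: "\<And>j::nat. j > 0 \<Longrightarrow> \<exists>A. finite A \<and> real (card A) \<le> C * 2 powr (real j * V) \<and>
        (\<forall>f\<in>H. \<exists>a\<in>A. L2_set (\<lambda>i. f i - a i) I \<le> (1/2) ^ j * \<rho>)"
    for I :: "'i set" and H :: "('i \<Rightarrow> real) set" and \<rho> :: real and J :: nat
  proof -
    \<comment> \<open>External centers are replaced by members of \<open>H\<close>, at the price of
      doubling the radius. The chain needs this because net points are themselves projected to the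
      next coarser net, and that net is only known to approximate \<open>H\<close>.\<close>
    have "\<exists>B. finite B \<and> B \<subseteq> H \<and> real (card B) \<le> C' * 2 powr (real j * V) \<and>
        (\<forall>f\<in>H. \<exists>a\<in>B. L2_set (\<lambda>i. f i - a i) I \<le> 2 * (1/2) ^ Suc j * \<rho>)" for j
    proof -
      obtain A where A: "finite A" "real (card A) \<le> C * 2 powr (real (Suc j) * V)"
        "\<And>f. f \<in> H \<Longrightarrow> \<exists>a\<in>A. L2_set (\<lambda>i. f i - a i) I \<le> (1/2) ^ Suc j * \<rho>"
        using nets[of "Suc j"] by auto
      define P where "P a f \<longleftrightarrow> f \<in> H \<and> L2_set (\<lambda>i. f i - a i) I \<le> (1/2) ^ Suc j * \<rho>" for a f
      define B where "B = (\<lambda>a. SOME f. P a f) ` {a \<in> A. \<exists>f. P a f}"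
      have P: "P a (SOME f. P a f)" if "\<exists>f. P a f" for a using someI_ex[OF that] .
      have "card B \<le> card A"
        unfolding B_def using A(1) by (intro order_trans[OF card_image_le card_mono]) auto
      then have "real (card B) \<le> C * 2 powr (real (Suc j) * V)" using A(2) by linarith
      also have "\<dots> = C' * 2 powr (real j * V)" by (simp add: C'_def powr_add algebra_simps)
      finally have "real (card B) \<le> C' * 2 powr (real j * V)" .
      moreover have "\<exists>a\<in>B. L2_set (\<lambda>i. f i - a i) I \<le> 2 * (1/2) ^ Suc j * \<rho>" if f: "f \<in> H" for f
      proof -
        obtain a where a: "a \<in> A" "P a f" using A(3)[OF f] f by (auto simp: P_def)
        define f' where "f' = (SOME f. P a f)"
        have f': "P a f'" "f' \<in> B" using P a by (auto simp: f'_def B_def)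
        have "L2_set (\<lambda>i. f i - f' i) I \<le> L2_set (\<lambda>i. f i - a i) I + L2_set (\<lambda>i. a i - f' i) I"
          by (rule order_trans[OF _ L2_set_triangle_ineq]) simp
        also have "L2_set (\<lambda>i. a i - f' i) I = L2_set (\<lambda>i. f' i - a i) I"
          unfolding L2_set_def by (simp add: power2_commute)
        finally show ?thesis using a(2) f' by (intro bexI[of _ f']) (auto simp: P_def)
      qed
      moreover have "B \<subseteq> H" using P by (auto simp: B_def P_def)
      ultimately show ?thesis using A(1) by (intro exI[of _ B]) (auto simp: B_def)
    qed
    then obtain N where N: "\<And>j. finite (N j)" "\<And>j. N j \<subseteq> H"
      "\<And>j. real (card (N j)) \<le> C' * 2 powr (real j * V)"
      "\<And>j f. f \<in> H \<Longrightarrow> \<exists>a\<in>N j. L2_set (\<lambda>i. f i - a i) I \<le> 2 * (1/2) ^ Suc j * \<rho>"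
      by metis
    \<comment> \<open>With the zero function as level 0, level \<open>j\<close> has radius
      \<open>2 * (1/2) ^ j * \<rho>\<close> throughout; at level 0 this holds because members of
      \<open>H\<close> have norm at most \<open>\<rho>\<close>.\<close>
    define Hs where "Hs j = (case j of 0 \<Rightarrow> {\<lambda>_::'i. 0::real} | Suc k \<Rightarrow> N k)" for j
    define \<pi> where "\<pi> j f = (SOME a. a \<in> Hs j \<and> L2_set (\<lambda>i. f i - a i) I \<le> 2 * (1/2) ^ j * \<rho>)" for j f
    have "\<exists>a. a \<in> Hs j \<and> L2_set (\<lambda>i. f i - a i) I \<le> 2 * (1/2) ^ j * \<rho>" if "f \<in> H" for j f
      using N(4)[OF that] bnd[OF that] \<rho> by (cases j) (auto simp: Hs_def)
    then have \<pi>: "\<pi> j f \<in> Hs j" "L2_set (\<lambda>i. f i - \<pi> j f i) I \<le> 2 * (1/2) ^ j * \<rho>" if "f \<in> H" for j f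
      using someI_ex[of "\<lambda>a. a \<in> Hs j \<and> L2_set (\<lambda>i. f i - a i) I \<le> 2 * (1/2) ^ j * \<rho>"] that
      unfolding \<pi>_def by blast+
    define S where "S j = 2 powr (real J * V) * (if j \<le> J then 8 ^ (J - j) else (1/2) ^ (j - J))" for j
    define T where "T j = C' * 2 powr (real j * V)" for j
    have ST: "S j > 0" "T j > 0" for j using C' by (auto simp: S_def T_def)
    define \<epsilon> where "\<epsilon> = (2::real) powr (- real J * (1 + V / 2))"
    obtain m :: nat where m: "(1/2::real) ^ m < \<epsilon> / 2"
      using real_arch_pow_inv[of "\<epsilon> / 2" "1/2"] by (auto simp: \<epsilon>_def)
    have HsH: "Hs (Suc j) \<subseteq> H" for j using N(2) by (simp add: Hs_def)
    obtain B where B: "finite B"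
      "real (card B) \<le> exp (\<Sum>j<Suc m. S j * ln (1 + T j / S j) + T j * ln (1 + S j / T j))"
      "\<And>(q::'t pmf) w. (\<And>t. w t \<in> Hs (Suc m)) \<Longrightarrow>
        (\<exists>b\<in>B. L2_set (\<lambda>i. measure_pmf.expectation q (\<lambda>t. w t i) - b i) I
          \<le> (\<Sum>j<Suc m. 2 * (2 * (1/2) ^ j * \<rho>) / sqrt (S j)))"
    proof -
      have "\<exists>B. finite B \<and>
        real (card B) \<le> exp (\<Sum>j<Suc m. S j * ln (1 + T j / S j) + T j * ln (1 + S j / T j)) \<and>
        (\<forall>(q::'t pmf) w. (\<forall>t. w t \<in> Hs (Suc m)) \<longrightarrow>
          (\<exists>b\<in>B. L2_set (\<lambda>i. measure_pmf.expectation q (\<lambda>t. w t i) - b i) I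
             \<le> (\<Sum>j<Suc m. 2 * (2 * (1/2) ^ j * \<rho>) / sqrt (S j))))"
      proof (rule means_cover_chain[where \<pi>=\<pi>])
        show "\<pi> j f \<in> Hs j" "L2_set (\<lambda>i. f i - \<pi> j f i) I \<le> 2 * (1/2) ^ j * \<rho>"
          if "f \<in> Hs (Suc j)" for j f
          using \<pi> HsH that by blast+
      qed (use I ST N(1,3) in \<open>auto simp: Hs_def T_def\<close>)
      then show thesis using that by blast
    qed
    have "(\<Sum>j<Suc m. S j * ln (1 + T j / S j) + T j * ln (1 + S j / T j)) \<le>
        (\<Sum>j<Suc m. 2 powr (real J * V) * (L * g1 (ndist J j)))"
      unfolding S_def T_def L_def g1_def q0_def by (intro sum_mono level_entropy_le C' V)
    also have "\<dots> = 2 powr (real J * V) * (L * (\<Sum>j<Suc m. g1 (ndist J j)))"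
      by (simp only: sum_distrib_left)
    also have "\<dots> \<le> 2 powr (real J * V) * K1"
      using sum_ndist_le[OF g1, of J "Suc m"] L
      by (intro mult_left_mono) (auto simp: K1_def intro!: add_increasing2 mult_left_mono simp del: sum.lessThan_Suc)
    finally have card: "real (card B) \<le> exp (K1 * 2 powr (real J * V))"
      using B(2) by (simp add: mult.commute order_trans[OF B(2)] del: sum.lessThan_Suc)
    have "(\<Sum>j<Suc m. 2 * (2 * (1/2) ^ j * \<rho>) / sqrt (S j)) = (\<Sum>j<Suc m. 4 * \<rho> * \<epsilon> * g2 (ndist J j))"
      unfolding S_def g2_def \<epsilon>_def by (intro sum.cong refl level_error_eq)
    also have "\<dots> = 4 * \<rho> * \<epsilon> * (\<Sum>j<Suc m. g2 (ndist J j))" by (simp only: sum_distrib_left)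
    also have "\<dots> \<le> 4 * \<rho> * \<epsilon> * (2 * suminf g2)"
      using sum_ndist_le[OF g2, of J "Suc m"] \<rho> by (intro mult_left_mono) (auto simp: \<epsilon>_def)
    finally have err: "(\<Sum>j<Suc m. 2 * (2 * (1/2) ^ j * \<rho>) / sqrt (S j)) \<le> 4 * \<rho> * \<epsilon> * (2 * suminf g2)" .
    have "\<exists>b\<in>B. L2_set (\<lambda>i. measure_pmf.expectation q (\<lambda>t. w t i) - b i) I \<le> K2 * \<epsilon> * \<rho>"
      if w: "\<And>t. w t \<in> H" for q :: "'t pmf" and w
    proof -
      \<comment> \<open>Projecting every function to the finest net moves the mean by at most
        \<open>\<epsilon> * \<rho>\<close>, by convexity of the norm. The \<open>+ 1\<close> in
        \<open>K2\<close> pays for it.\<close>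
      define w' where "w' t = \<pi> (Suc m) (w t)" for t
      have w': "w' t \<in> Hs (Suc m)" for t using \<pi> w by (simp add: w'_def)
      obtain b where b: "b \<in> B" "L2_set (\<lambda>i. measure_pmf.expectation q (\<lambda>t. w' t i) - b i) I
          \<le> (\<Sum>j<Suc m. 2 * (2 * (1/2) ^ j * \<rho>) / sqrt (S j))"
        using B(3)[where w=w' and q=q, OF w'] by blast
      have d: "L2_set (\<lambda>i. w t i - w' t i) I \<le> \<epsilon> * \<rho>" for t
      proof -
        have "L2_set (\<lambda>i. w t i - w' t i) I \<le> 2 * (1/2) ^ Suc m * \<rho>" unfolding w'_def by (rule \<pi>(2)[OF w])
        also have "\<dots> \<le> \<epsilon> * \<rho>" using m zero_le_power[of "1/2::real" m] \<rho> unfolding power_Suc by (intro mult_right_mono) linarith+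
        finally show ?thesis .
      qed
      have int: "integrable (measure_pmf q) (\<lambda>t. w t i)" if i: "i \<in> I" for i
      proof (rule measure_pmf.integrable_const_bound[where B=\<rho>])
        show "AE t in measure_pmf q. norm (w t i) \<le> \<rho>"
        proof (rule AE_I2)
          fix t
          show "norm (w t i) \<le> \<rho>"
            using member_le_L2_set[OF I i, of "\<lambda>j. \<bar>w t j\<bar>"] bnd[OF w, of t]
            by (simp add: L2_set_def)
        qed
      qed auto
      have int': "integrable (measure_pmf q) (\<lambda>t. w' t i)" for i
        using w' N(1) by (intro integrable_pmf_finite_values[of "Hs (Suc m)"]) (auto simp: Hs_def)
      have P: "prob_space (measure_pmf q)" by unfold_locales
      have j: "L2_set (\<lambda>i. measure_pmf.expectation q (\<lambda>t. w t i - w' t i)) I \<le> \<epsilon> * \<rho>"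
        by (rule L2_set_expectation_le[OF P I, of "\<lambda>t i. w t i - w' t i"]) (use d in auto)
      have "L2_set (\<lambda>i. measure_pmf.expectation q (\<lambda>t. w t i) - b i) I =
        L2_set (\<lambda>i. measure_pmf.expectation q (\<lambda>t. w t i - w' t i) + (measure_pmf.expectation q (\<lambda>t. w' t i) - b i)) I"
        using int int' by (intro L2_set_cong) auto
      also have "\<dots> \<le> \<epsilon> * \<rho> + 4 * \<rho> * \<epsilon> * (2 * suminf g2)"
        using b(2) j err by (intro order_trans[OF L2_set_triangle_ineq]) linarith
      also have "\<dots> = K2 * \<epsilon> * \<rho>" by (simp add: K2_def algebra_simps)
      finally show ?thesis using b(1) by blast
    qed
    then show ?thesis using B(1) card unfolding \<epsilon>_def by blast
  qed
  show thesis by (rule that[OF K]) (rule main)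
qed

section \<open>Symmetrization\<close>

text \<open>Chernoff's bound for the lower tail, with the weight \<open>2 powr (- count)\<close>:
  its mean is \<open>(1 - p / 2) ^ n\<close>, so Markov's inequality bounds the failure probability
  by \<open>exp (- p * n * (1 - ln 2) / 2)\<close>. An expected count of 8 makes this at most
  \<open>1 / 2\<close>.\<close>

lemma half_count_prob:
  fixes D :: "'z measure" and J :: "'i set"
  assumes D: "prob_space D" and J: "finite J" and A: "A \<in> sets D"
    and large: "8 \<le> measure D A * card J"
  shows "1 / 2 \<le> measure (Pi\<^sub>M J (\<lambda>_. D))
    {y \<in> space (Pi\<^sub>M J (\<lambda>_. D)). measure D A * card J / 2 \<le> (\<Sum>j\<in>J. indicator A (y j))}"
proof -
  interpret D: prob_space D by (rule D)
  interpret product_prob_space "\<lambda>_. D" J by unfold_locales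
  interpret finite_product_prob_space "\<lambda>_. D" J using J by unfold_locales
  let ?P = "Pi\<^sub>M J (\<lambda>_. D)"
  define p where "p = measure D A"
  define n where "n = real (card J)"
  have p: "0 \<le> p" "p \<le> 1" by (auto simp: p_def)
  define u :: "('i \<Rightarrow> 'z) \<Rightarrow> real" where "u y = (\<Prod>j\<in>J. 1 - indicator A (y j) / 2)" for y
  have u_powr: "u y = 2 powr (- (\<Sum>j\<in>J. indicator A (y j)))" for y
  proof -
    have "2 powr (- (\<Sum>j\<in>J. indicator A (y j))) = (\<Prod>j\<in>J. (2::real) powr (- indicator A (y j)))"
      unfolding sum_negf[symmetric] by (rule powr_sum) (use J in auto)
    also have "\<dots> = u y" unfolding u_def by (intro prod.cong refl) (auto simp: indicator_def powr_minus)
    finally show ?thesis by simp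
  qed
  have u_nonneg: "0 \<le> u y" for y by (simp add: u_powr)
  have intA: "integrable D (\<lambda>z. 1 - indicator A z / 2 :: real)"
    using A by (intro Bochner_Integration.integrable_diff integrable_divide) (auto simp: integrable_indicator_iff D.emeasure_finite less_top[symmetric])
  have int_u: "integrable ?P u"
    unfolding u_def using product_integrable_prod[OF J, of "\<lambda>_ z. 1 - indicat_real A z / 2"] intA by simp
  have "(\<integral>y. u y \<partial>?P) = (\<Prod>j\<in>J. \<integral>z. 1 - indicator A z / 2 \<partial>D)"
    unfolding u_def using product_integral_prod[OF J, of "\<lambda>_ z. 1 - indicat_real A z / 2"] intA by simp
  also have "(\<integral>z. 1 - indicator A z / 2 \<partial>D) = 1 - p / 2"
    using A by (subst Bochner_Integration.integral_diff)
      (auto simp: integrable_indicator_iff D.emeasure_finite less_top[symmetric] p_def D.prob_space intro!: integrable_divide)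
  finally have Eu: "(\<integral>y. u y \<partial>?P) = (1 - p / 2) powr n"
    using p J by (simp add: n_def powr_realpow)
  let ?G = "{y \<in> space ?P. p * n / 2 \<le> (\<Sum>j\<in>J. indicator A (y j))}"
  note [measurable] = A
  have [measurable]: "(\<lambda>y. \<Sum>j\<in>J. indicat_real A (y j)) \<in> borel_measurable ?P"
    by measurable
  have "measure ?P (space ?P - ?G) \<le> measure ?P {y \<in> space ?P. 2 powr (- (p * n / 2)) \<le> u y}"
    using int_u by (intro finite_measure_mono) (auto simp: u_powr)
  also have "\<dots> \<le> (\<integral>y. u y \<partial>?P) / 2 powr (- (p * n / 2))"
    by (rule integral_Markov_inequality_measure[where A="{}"]) (use int_u in \<open>auto simp: u_powr[symmetric] u_nonneg\<close>)
  also have "\<dots> = exp (n * ln (1 - p / 2) + p * n / 2 * ln 2)"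
    unfolding Eu divide_powr_uminus exp_add using p by (simp add: powr_def)
  also have "\<dots> \<le> exp (- ln 2)"
  proof (rule exp_mono)
    have "n * ln (1 - p / 2) \<le> n * (- (p / 2))"
      using p ln_le_minus_one[of "1 - p / 2"] by (intro mult_left_mono) (auto simp: n_def)
    then have "n * ln (1 - p / 2) + p * n / 2 * ln 2 \<le> - ((p * n) * (1 - ln 2) / 2)"
      by (simp add: algebra_simps diff_divide_distrib)
    also have "\<dots> \<le> - (8 * (1 - ln 2) / 2)"
    proof -
      have "8 * (1 - ln 2) \<le> (p * n) * (1 - ln 2)"
        using large ln2_le_25_over_36 unfolding p_def n_def by (intro mult_right_mono) auto
      then show ?thesis by linarith
    qed
    also have "\<dots> \<le> - ln 2" using ln2_le_25_over_36 by simp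
    finally show "n * ln (1 - p / 2) + p * n / 2 * ln 2 \<le> - ln 2" .
  qed
  finally have "measure ?P (space ?P - ?G) \<le> 1 / 2" by (simp add: exp_minus)
  moreover have "measure ?P (space ?P - ?G) = 1 - measure ?P ?G"
    by (rule prob_compl) measurable
  ultimately show ?thesis by (simp add: p_def n_def)
qed

text \<open>Indices below \<open>N\<close> belong to the sample, those from \<open>N\<close> to
  \<open>2 * N - 1\<close> to the ghost sample. The set \<open>\<sigma>\<close> plays the part of a
  vector of random signs: it selects the pairs \<open>i\<close>, \<open>i + N\<close> that are
  exchanged.\<close>

definition swap_halves :: "nat \<Rightarrow> nat set \<Rightarrow> nat \<Rightarrow> nat" where
  "swap_halves N \<sigma> i = (if i < N then (if i \<in> \<sigma> then i + N else i) else (if i - N \<in> \<sigma> then i - N else i))"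

lemma inj_on_swap_halves: "inj_on (swap_halves N \<sigma>) {..<2 * N}"
  unfolding inj_on_def swap_halves_def by (auto split: if_splits)

lemma swap_halves_less: "\<sigma> \<subseteq> {..<N} \<Longrightarrow> i < 2 * N \<Longrightarrow> swap_halves N \<sigma> i < 2 * N"
  unfolding swap_halves_def by (auto split: if_splits)

text \<open>The base \<open>3 / 2\<close> is admissible because \<open>3 / 2 + (3 / 2) powr (- 2) \<le> 2\<close>: a pair with
  exactly one point in \<open>P\<close> contributes \<open>1\<close> or \<open>- 2\<close> with equal probability.\<close>

lemma card_swaps_le:
  fixes s :: real and P :: "nat set"
  shows "real (card {\<sigma> \<in> Pow {..<N}.
      2 * (\<Sum>i<N. indicator P (swap_halves N \<sigma> i)) + s \<le> (\<Sum>i<N. indicator P (swap_halves N \<sigma> (i + N)))})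
    \<le> 2 ^ N * (3 / 2) powr (- s)"
proof -
  define x :: "nat set \<Rightarrow> nat \<Rightarrow> real" where
    "x \<sigma> i = indicator P (swap_halves N \<sigma> (i + N)) - 2 * indicator P (swap_halves N \<sigma> i)" for \<sigma> i
  define a b :: "nat \<Rightarrow> real" where "a i = (3/2) powr (indicator P i - 2 * indicator P (i + N))"
    and "b i = (3/2) powr (indicator P (i + N) - 2 * indicator P i)" for i
  have ab: "a i + b i \<le> 2" for i
    unfolding a_def b_def by (auto simp: indicator_def powr_minus powr_numeral power2_eq_square)
  have ab0: "0 \<le> a i" "0 \<le> b i" for i by (auto simp: a_def b_def)
  let ?S = "{\<sigma> \<in> Pow {..<N}.
      2 * (\<Sum>i<N. indicator P (swap_halves N \<sigma> i)) + s \<le> (\<Sum>i<N. indicator P (swap_halves N \<sigma> (i + N)))}"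
  have "real (card ?S) * (3/2) powr s = (\<Sum>\<sigma>\<in>?S. (3/2) powr s)" by simp
  also have "\<dots> \<le> (\<Sum>\<sigma>\<in>?S. (3/2) powr (\<Sum>i<N. x \<sigma> i))"
    by (intro sum_mono powr_mono) (auto simp: x_def sum_subtractf sum_distrib_left)
  also have "\<dots> \<le> (\<Sum>\<sigma>\<in>Pow {..<N}. (3/2) powr (\<Sum>i<N. x \<sigma> i))"
    by (intro sum_mono2) auto
  also have "\<dots> = (\<Sum>\<sigma>\<in>Pow {..<N}. (\<Prod>i\<in>\<sigma>. a i) * (\<Prod>i\<in>{..<N} - \<sigma>. b i))"
  proof (intro sum.cong refl)
    fix \<sigma> assume "\<sigma> \<in> Pow {..<N}"
    then have \<sigma>: "\<sigma> \<subseteq> {..<N}" by simp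
    have "(3/2) powr (\<Sum>i<N. x \<sigma> i) = (\<Prod>i<N. (3/2) powr x \<sigma> i)"
      by (rule powr_sum) auto
    also have "\<dots> = (\<Prod>i\<in>{..<N} - \<sigma>. (3/2) powr x \<sigma> i) * (\<Prod>i\<in>\<sigma>. (3/2) powr x \<sigma> i)"
      using \<sigma> by (intro prod.subset_diff) auto
    also have "(\<Prod>i\<in>{..<N} - \<sigma>. (3/2) powr x \<sigma> i) = (\<Prod>i\<in>{..<N} - \<sigma>. b i)"
      by (intro prod.cong refl) (auto simp: x_def b_def swap_halves_def)
    also have "(\<Prod>i\<in>\<sigma>. (3/2) powr x \<sigma> i) = (\<Prod>i\<in>\<sigma>. a i)"
      using \<sigma> by (intro prod.cong refl) (auto simp: x_def a_def swap_halves_def)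
    finally show "(3/2) powr (\<Sum>i<N. x \<sigma> i) = (\<Prod>i\<in>\<sigma>. a i) * (\<Prod>i\<in>{..<N} - \<sigma>. b i)"
      by (simp add: mult.commute)
  qed
  \<comment> \<open>Summing over all subsets factorizes over the pairs; this is the independence of
    the random signs.\<close>
  also have "\<dots> = (\<Prod>i<N. a i + b i)" by (rule prod_add[symmetric]) auto
  also have "\<dots> \<le> (\<Prod>i<N. 2)" using ab ab0 by (intro prod_mono) (auto intro: add_nonneg_nonneg)
  finally show ?thesis by (simp add: powr_minus field_simps)
qed

text \<open>Only indices in \<open>F\<close> can be counted on the left and not on the right, and
  injectivity of \<open>f\<close> lets each of them occur once.\<close>

lemma sum_indicator_le_card:
  fixes f g :: "nat \<Rightarrow> nat"
  assumes "inj_on f {..<N}" "\<And>i. i < N \<Longrightarrow> f i \<in> A \<Longrightarrow> f i \<notin> A' \<Longrightarrow> f i \<in> F" "finite F"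
  shows "(\<Sum>i<N. indicator A (f i)) \<le> (\<Sum>i<N. indicator A' (f i)) + real (card F)"
proof -
  have "(\<Sum>i<N. indicator A (f i)) \<le> (\<Sum>i<N. indicator A' (f i) + indicator F (f i) :: real)"
    using assms(2) by (intro sum_mono) (auto simp: indicator_def)
  also have "\<dots> = (\<Sum>i<N. indicator A' (f i)) + (\<Sum>i<N. indicator F (f i))" by (rule sum.distrib)
  also have "(\<Sum>i<N. indicator F (f i)) = sum (indicator F :: nat \<Rightarrow> real) (f ` {..<N})"
    using assms(1) by (simp add: sum.reindex)
  also have "\<dots> = real (card (F \<inter> f ` {..<N}))" by (simp add: indicator_def sum.If_cases Int_commute)
  also have "\<dots> \<le> real (card F)" using assms(3) by (intro of_nat_mono card_mono) auto
  finally show ?thesis by simp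
qed

text \<open>The law of the double sample is invariant under swaps, so the probability of
  \<open>E\<close> is an average over all swaps of one fixed double sample, where
  \<open>\<Phi>\<close> may be replaced by the finite cover belonging to it. The cover is cut at
  \<open>a + \<tau>\<close>, halfway between the two thresholds; this misplaces at most
  \<open>k\<close> indices in either count. As the sample is counted twice, the total loss is
  \<open>3 * k\<close>.\<close>

lemma double_sample_bound:
  fixes D :: "'z measure" and \<Phi> :: "('z \<Rightarrow> real) set" and a \<tau> s k \<epsilon> :: real and N :: nat
  assumes D: "prob_space D" and \<Phi>: "countable \<Phi>" "\<And>\<phi>. \<phi> \<in> \<Phi> \<Longrightarrow> \<phi> \<in> borel_measurable D"
    and cover: "\<And>\<omega>. \<omega> \<in> space (Pi\<^sub>M {..<2 * N} (\<lambda>_. D)) \<Longrightarrow>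
      \<exists>B. finite B \<and> real (card B) \<le> exp \<epsilon> \<and>
        (\<forall>\<phi>\<in>\<Phi>. \<exists>b\<in>B. real (card {i\<in>{..<2 * N}. \<tau> < \<bar>\<phi> (\<omega> i) - b i\<bar>}) \<le> k)"
  defines "E \<equiv> {\<omega> \<in> space (Pi\<^sub>M {..<2 * N} (\<lambda>_. D)). \<exists>\<phi>\<in>\<Phi>.
      2 * (\<Sum>i<N. indicator {..a + 2 * \<tau>} (\<phi> (\<omega> i))) + s + 3 * k \<le> (\<Sum>i<N. indicator {..a} (\<phi> (\<omega> (i + N))))}"
  shows "E \<in> sets (Pi\<^sub>M {..<2 * N} (\<lambda>_. D))"
    and "measure (Pi\<^sub>M {..<2 * N} (\<lambda>_. D)) E \<le> exp \<epsilon> * (3/2) powr (- s)"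
proof -
  interpret D: prob_space D by (rule D)
  interpret product_prob_space "\<lambda>_. D" "{..<2 * N}" by unfold_locales
  interpret finite_product_prob_space "\<lambda>_. D" "{..<2 * N}" by unfold_locales auto
  let ?P = "Pi\<^sub>M {..<2 * N} (\<lambda>_. D)"
  have m1: "(\<lambda>\<omega>. \<phi> (\<omega> i)) \<in> borel_measurable ?P" if "\<phi> \<in> \<Phi>" "i < 2 * N" for \<phi> i
    using that \<Phi>(2) by (intro measurable_compose[OF measurable_component_singleton]) auto
  have m2: "(\<lambda>\<omega>. \<Sum>i<N. indicat_real {..c} (\<phi> (\<omega> (f i)))) \<in> borel_measurable ?P"
    if "\<phi> \<in> \<Phi>" "\<And>i. i < N \<Longrightarrow> f i < 2 * N" for \<phi> f and c :: real
  proof (intro borel_measurable_sum)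
    fix i assume "i \<in> {..<N}"
    then have "f i < 2 * N" using that by auto
    from m1[OF that(1) this] show "(\<lambda>\<omega>. indicator {..c} (\<phi> (\<omega> (f i))) :: real) \<in> borel_measurable ?P"
      by measurable
  qed
  have "{\<omega> \<in> space ?P. 2 * (\<Sum>i<N. indicator {..a + 2 * \<tau>} (\<phi> (\<omega> i))) + s + 3 * k
      \<le> (\<Sum>i<N. indicator {..a} (\<phi> (\<omega> (i + N))))} \<in> sets ?P" if "\<phi> \<in> \<Phi>" for \<phi>
    by (intro borel_measurable_le borel_measurable_add borel_measurable_times borel_measurable_const
        m2[OF that, of id, simplified] m2[OF that, of "\<lambda>i. i + N"]) auto
  then show sE: "E \<in> sets ?P"
    unfolding E_def by (rule sets.sets_Collect_countable_Ex'[OF _ \<Phi>(1)])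
  define T where "T \<sigma> \<omega> = (\<lambda>n\<in>{..<2 * N}. \<omega> (swap_halves N \<sigma> n))" for \<sigma> and \<omega> :: "nat \<Rightarrow> 'z"
  have less: "swap_halves N \<sigma> i < 2 * N" if "\<sigma> \<in> Pow {..<N}" "i < 2 * N" for \<sigma> i
    using swap_halves_less that by auto
  have T_meas: "T \<sigma> \<in> measurable ?P ?P" if "\<sigma> \<in> Pow {..<N}" for \<sigma>
    unfolding T_def using less[OF that] by (intro measurable_restrict measurable_component_singleton) auto
  have T_distr: "distr ?P ?P (T \<sigma>) = ?P" if "\<sigma> \<in> Pow {..<N}" for \<sigma>
    unfolding T_def using distr_PiM_reindex[of "{..<2 * N}" "\<lambda>_. D" "swap_halves N \<sigma>" "{..<2 * N}"]
      inj_on_swap_halves less[OF that] D by auto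
  have inv: "measure ?P E = (\<integral>\<omega>. indicator E (T \<sigma> \<omega>) \<partial>?P)" if "\<sigma> \<in> Pow {..<N}" for \<sigma>
  proof -
    have "measure ?P E = (\<integral>\<omega>. indicator E \<omega> \<partial>distr ?P ?P (T \<sigma>))"
      using sE unfolding T_distr[OF that] by simp
    also have "\<dots> = (\<integral>\<omega>. indicator E (T \<sigma> \<omega>) \<partial>?P)"
      using T_meas[OF that] sE by (intro integral_distr) auto
    finally show ?thesis .
  qed
  have int: "integrable ?P (\<lambda>\<omega>. indicator E (T \<sigma> \<omega>) :: real)" if "\<sigma> \<in> Pow {..<N}" for \<sigma>
    using measurable_compose[OF T_meas[OF that], of "indicator E :: _ \<Rightarrow> real" borel] sE
    by (intro integrable_const_bound[where B=1]) auto
  have pt: "(\<Sum>\<sigma>\<in>Pow {..<N}. indicator E (T \<sigma> \<omega>)) \<le> exp \<epsilon> * (2 ^ N * (3/2) powr (- s))"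
    if \<omega>: "\<omega> \<in> space ?P" for \<omega>
  proof -
    obtain B where B: "finite B" "real (card B) \<le> exp \<epsilon>"
      "\<And>\<phi>. \<phi> \<in> \<Phi> \<Longrightarrow> \<exists>b\<in>B. real (card {i\<in>{..<2 * N}. \<tau> < \<bar>\<phi> (\<omega> i) - b i\<bar>}) \<le> k"
      using cover[OF \<omega>] by blast
    \<comment> \<open>For fixed \<open>\<omega>\<close> the level set of \<open>b\<close> is a fixed
      set of indices, to which \<open>card_swaps_le\<close> applies.\<close>
    define W where "W b = {\<sigma> \<in> Pow {..<N}.
      2 * (\<Sum>i<N. indicator {i. b i \<le> a + \<tau>} (swap_halves N \<sigma> i)) + s
        \<le> (\<Sum>i<N. indicator {i. b i \<le> a + \<tau>} (swap_halves N \<sigma> (i + N)))}" for b :: "nat \<Rightarrow> real"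
    have "\<sigma> \<in> (\<Union>b\<in>B. W b)" if \<sigma>: "\<sigma> \<in> Pow {..<N}" and TE: "T \<sigma> \<omega> \<in> E" for \<sigma>
    proof -
      obtain \<phi> where \<phi>: "\<phi> \<in> \<Phi>" "2 * (\<Sum>i<N. indicator {..a + 2 * \<tau>} (\<phi> (T \<sigma> \<omega> i))) + s + 3 * k
          \<le> (\<Sum>i<N. indicator {..a} (\<phi> (T \<sigma> \<omega> (i + N))))"
        using TE by (auto simp: E_def)
      obtain b where b: "b \<in> B" "real (card {i\<in>{..<2 * N}. \<tau> < \<bar>\<phi> (\<omega> i) - b i\<bar>}) \<le> k"
        using B(3)[OF \<phi>(1)] by blast
      let ?F = "{i\<in>{..<2 * N}. \<tau> < \<bar>\<phi> (\<omega> i) - b i\<bar>}"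
      let ?U = "{i. b i \<le> a + \<tau>}"
      have l1: "swap_halves N \<sigma> i < 2 * N" "swap_halves N \<sigma> (i + N) < 2 * N" if "i < N" for i
        using less[OF \<sigma>] that by auto
      have "(\<Sum>i<N. indicator {..a} (\<phi> (T \<sigma> \<omega> (i + N))))
          = (\<Sum>i<N. indicator {j. \<phi> (\<omega> j) \<le> a} (swap_halves N \<sigma> (i + N)))"
        by (intro sum.cong refl) (auto simp: T_def indicator_def)
      also have "\<dots> \<le> (\<Sum>i<N. indicator ?U (swap_halves N \<sigma> (i + N))) + real (card ?F)"
      proof (rule sum_indicator_le_card)
        show "inj_on (\<lambda>i. swap_halves N \<sigma> (i + N)) {..<N}"
        proof (rule inj_onI)
          fix x y assume "x \<in> {..<N}" "y \<in> {..<N}" "swap_halves N \<sigma> (x + N) = swap_halves N \<sigma> (y + N)"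
          then show "x = y" using inj_onD[OF inj_on_swap_halves, of N \<sigma> "x + N" "y + N"] by simp
        qed
      qed (use l1 in \<open>auto simp: abs_if\<close>)
      finally have c1: "(\<Sum>i<N. indicator {..a} (\<phi> (T \<sigma> \<omega> (i + N))))
          \<le> (\<Sum>i<N. indicator ?U (swap_halves N \<sigma> (i + N))) + k" using b(2) by linarith
      have "(\<Sum>i<N. indicator ?U (swap_halves N \<sigma> i)) \<le>
          (\<Sum>i<N. indicator {j. \<phi> (\<omega> j) \<le> a + 2 * \<tau>} (swap_halves N \<sigma> i)) + real (card ?F)"
      proof (rule sum_indicator_le_card)
        show "inj_on (swap_halves N \<sigma>) {..<N}"
          using inj_on_swap_halves[of N \<sigma>] by (auto simp: inj_on_def)
      qed (use l1 in \<open>auto simp: abs_if\<close>)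
      also have "(\<Sum>i<N. indicator {j. \<phi> (\<omega> j) \<le> a + 2 * \<tau>} (swap_halves N \<sigma> i))
          = (\<Sum>i<N. indicator {..a + 2 * \<tau>} (\<phi> (T \<sigma> \<omega> i)) :: real)"
        by (intro sum.cong refl) (auto simp: T_def indicator_def)
      finally have "(\<Sum>i<N. indicator ?U (swap_halves N \<sigma> i)) \<le>
          (\<Sum>i<N. indicator {..a + 2 * \<tau>} (\<phi> (T \<sigma> \<omega> i))) + k" using b(2) by linarith
      then have "2 * (\<Sum>i<N. indicator ?U (swap_halves N \<sigma> i)) + s
          \<le> (\<Sum>i<N. indicator ?U (swap_halves N \<sigma> (i + N)))" using c1 \<phi>(2) by linarith
      then show ?thesis using b(1) \<sigma> by (auto simp: W_def)
    qed
    then have sub: "{\<sigma> \<in> Pow {..<N}. T \<sigma> \<omega> \<in> E} \<subseteq> (\<Union>b\<in>B. W b)" by blast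
    have finW: "finite (\<Union>b\<in>B. W b)" using B(1) by (auto simp: W_def)
    have "(\<Sum>\<sigma>\<in>Pow {..<N}. indicator E (T \<sigma> \<omega>)) = real (card {\<sigma> \<in> Pow {..<N}. T \<sigma> \<omega> \<in> E})"
      by (simp add: indicator_def sum.If_cases Int_def)
    also have "\<dots> \<le> real (card (\<Union>b\<in>B. W b))" by (intro of_nat_mono card_mono sub finW)
    also have "\<dots> \<le> (\<Sum>b\<in>B. real (card (W b)))"
      using card_UN_le[OF B(1), of W] by (simp flip: of_nat_sum)
    also have "\<dots> \<le> (\<Sum>b\<in>B. 2 ^ N * (3/2) powr (- s))"
      unfolding W_def by (intro sum_mono card_swaps_le)
    also have "\<dots> \<le> exp \<epsilon> * (2 ^ N * (3/2) powr (- s))"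
      using B(2) by (simp add: mult_right_mono)
    finally show ?thesis .
  qed
  have "2 ^ N * measure ?P E = (\<Sum>\<sigma>\<in>Pow {..<N}. measure ?P E)" by (simp add: card_Pow)
  also have "\<dots> = (\<Sum>\<sigma>\<in>Pow {..<N}. (\<integral>\<omega>. indicator E (T \<sigma> \<omega>) \<partial>?P))"
    by (intro sum.cong refl inv)
  also have "\<dots> = (\<integral>\<omega>. (\<Sum>\<sigma>\<in>Pow {..<N}. indicator E (T \<sigma> \<omega>)) \<partial>?P)"
    by (rule Bochner_Integration.integral_sum[symmetric]) (rule int)
  also have "\<dots> \<le> exp \<epsilon> * (2 ^ N * (3/2) powr (- s))"
    using int pt by (intro integral_le_const Bochner_Integration.integrable_sum AE_I2) auto
  finally show "measure ?P E \<le> exp \<epsilon> * (3/2) powr (- s)"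
    by (simp add: algebra_simps)
qed


text \<open>Ghost sample argument: if the first half is bad for some \<open>\<phi>\<close>, the
  ghost count reaches half its expectation with probability at least \<open>1 / 2\<close>. Hence
  \<open>Bad\<close> is at most twice as likely as the event \<open>E\<close> of the double sample,
  which the condition on \<open>\<epsilon>\<close> and \<open>\<delta>\<close> makes at most
  \<open>\<delta> / 2\<close> likely.\<close>

lemma relative_deviation_bound:
  fixes D :: "'z measure" and \<Phi> :: "('z \<Rightarrow> real) set" and a \<tau> t k \<epsilon> \<delta> :: real and N :: nat
  assumes D: "prob_space D" and \<Phi>: "countable \<Phi>" "\<And>\<phi>. \<phi> \<in> \<Phi> \<Longrightarrow> \<phi> \<in> borel_measurable D"
    and cover: "\<And>\<omega>. \<omega> \<in> space (Pi\<^sub>M {..<2 * N} (\<lambda>_. D)) \<Longrightarrow>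
      \<exists>B. finite B \<and> real (card B) \<le> exp \<epsilon> \<and>
        (\<forall>\<phi>\<in>\<Phi>. \<exists>b\<in>B. real (card {i\<in>{..<2 * N}. \<tau> < \<bar>\<phi> (\<omega> i) - b i\<bar>}) \<le> k)"
    and N: "N > 0" and \<delta>: "\<delta> > 0" and t8: "8 \<le> t * N"
    and t: "\<epsilon> + ln (2 / \<delta>) \<le> (t * N / 2 - 3 * k) * ln (3 / 2)"
  obtains Bad where "Bad \<in> sets (Pi\<^sub>M {..<N} (\<lambda>_. D))" "measure (Pi\<^sub>M {..<N} (\<lambda>_. D)) Bad \<le> \<delta>"
    "\<And>S \<phi>. S \<in> space (Pi\<^sub>M {..<N} (\<lambda>_. D)) \<Longrightarrow> S \<notin> Bad \<Longrightarrow> \<phi> \<in> \<Phi> \<Longrightarrow>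
      measure D {z \<in> space D. \<phi> z \<le> a} \<le> t + 4 * (\<Sum>i<N. indicator {..a + 2 * \<tau>} (\<phi> (S i))) / N"
proof -
  interpret D: prob_space D by (rule D)
  interpret product_sigma_finite "\<lambda>_::nat. D" by unfold_locales
  define I J where "I = {..<N}" and "J = {N..<2 * N}"
  have IJ: "I \<inter> J = {}" "finite I" "finite J" "{..<2 * N} = I \<union> J" "card J = N"
    by (auto simp: I_def J_def)
  let ?P = "Pi\<^sub>M I (\<lambda>_. D)" and ?Q = "Pi\<^sub>M J (\<lambda>_. D)" and ?R = "Pi\<^sub>M (I \<union> J) (\<lambda>_. D)"
  interpret P: prob_space ?P by (intro prob_space_PiM D)
  interpret Q: prob_space ?Q by (intro prob_space_PiM D)
  interpret R: prob_space ?R by (intro prob_space_PiM D)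
  \<comment> \<open>Halving \<open>t * N + 4 * c \<phi> S < p \<phi> * N\<close> leaves
    \<open>t * N / 2 + 2 * c \<phi> S\<close>, and \<open>t * N / 2\<close> is then exactly the
    \<open>s + 3 * k\<close> required in \<open>E\<close>.\<close>
  define s where "s = t * N / 2 - 3 * k"
  define E where "E = {\<omega> \<in> space ?R. \<exists>\<phi>\<in>\<Phi>.
      2 * (\<Sum>i<N. indicator {..a + 2 * \<tau>} (\<phi> (\<omega> i))) + s + 3 * k \<le> (\<Sum>i<N. indicator {..a} (\<phi> (\<omega> (i + N))))}"
  have sE: "E \<in> sets ?R" and mE: "measure ?R E \<le> exp \<epsilon> * (3/2) powr (- s)"
    using double_sample_bound[OF D \<Phi> cover, of a s] unfolding E_def IJ(4) by auto
  have "exp \<epsilon> * (3/2) powr (- s) = exp (\<epsilon> - s * ln (3/2))" by (simp add: powr_def exp_diff exp_minus field_simps)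
  also have "\<dots> \<le> exp (- ln (2 / \<delta>))" using t unfolding s_def by (intro exp_mono) linarith
  also have "\<dots> = \<delta> / 2" using \<delta> by (simp add: exp_minus)
  finally have mE: "measure ?R E \<le> \<delta> / 2" using mE by linarith
  define p where "p \<phi> = measure D {z \<in> space D. \<phi> z \<le> a}" for \<phi>
  define c where "c \<phi> S = (\<Sum>i<N. indicat_real {..a + 2 * \<tau>} (\<phi> (S i)))" for \<phi> :: "'z \<Rightarrow> real" and S
  define Bad where "Bad = {S \<in> space ?P. \<exists>\<phi>\<in>\<Phi>. t + 4 * c \<phi> S / N < p \<phi>}"
  have cm: "c \<phi> \<in> borel_measurable ?P" if "\<phi> \<in> \<Phi>" for \<phi>
    unfolding c_def
  proof (intro borel_measurable_sum)
    fix i assume "i \<in> {..<N}"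
    then have "(\<lambda>S. \<phi> (S i)) \<in> borel_measurable ?P"
      using \<Phi>(2)[OF that] by (intro measurable_compose[OF measurable_component_singleton]) (auto simp: I_def)
    then show "(\<lambda>S. indicat_real {..a + 2 * \<tau>} (\<phi> (S i))) \<in> borel_measurable ?P" by measurable
  qed
  have sBad: "Bad \<in> sets ?P"
    unfolding Bad_def
  proof (rule sets.sets_Collect_countable_Ex'[OF _ \<Phi>(1)])
    fix \<phi> assume "\<phi> \<in> \<Phi>"
    note [measurable] = cm[OF this]
    show "{S \<in> space ?P. t + 4 * c \<phi> S / N < p \<phi>} \<in> sets ?P" by measurable
  qed
  \<comment> \<open>The witness \<open>\<phi>\<close> is determined by \<open>S\<close> alone, so
    the ghost sample \<open>y\<close> is still independent of it. Integration over \<open>S\<close>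
    then compares the probabilities of \<open>Bad\<close> and \<open>E\<close>.\<close>
  have ghost: "ennreal (1 / 2) * indicator Bad S \<le> (\<integral>\<^sup>+ y. indicator E (merge I J (S, y)) \<partial>?Q)"
    if S: "S \<in> space ?P" for S
  proof (cases "S \<in> Bad")
    case True
    then obtain \<phi> where \<phi>: "\<phi> \<in> \<Phi>" "t + 4 * c \<phi> S / N < p \<phi>" by (auto simp: Bad_def)
    define A where "A = {z \<in> space D. \<phi> z \<le> a}"
    have A: "A \<in> sets D" unfolding A_def using \<Phi>(2)[OF \<phi>(1)] by measurable
    have c0: "0 \<le> c \<phi> S" unfolding c_def by (intro sum_nonneg) auto
    have pN: "t * N + 4 * c \<phi> S < p \<phi> * N" using \<phi>(2) N by (simp add: field_simps)
    have "8 \<le> measure D A * real (card J)"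
      using pN t8 c0 unfolding p_def A_def IJ(5) by linarith
    note hc = half_count_prob[OF D IJ(3) A this]
    let ?G = "{y \<in> space ?Q. measure D A * card J / 2 \<le> (\<Sum>j\<in>J. indicator A (y j))}"
    have sG: "?G \<in> sets ?Q"
    proof -
      have [measurable]: "A \<in> sets D" by (rule A)
      show ?thesis by measurable
    qed
    have "merge I J (S, y) \<in> E" if y: "y \<in> ?G" for y
    proof -
      have ysp: "y \<in> space ?Q" using y by simp
      have sp: "merge I J (S, y) \<in> space ?R"
        using S ysp measurable_space[OF measurable_merge, of "(S, y)" I "\<lambda>_. D" J]
        by (simp add: space_pair_measure)
      have "p \<phi> * N / 2 \<le> (\<Sum>j\<in>J. indicat_real A (y j))" using y by (simp add: A_def p_def IJ(5))
      also have "\<dots> = (\<Sum>i<N. indicat_real A (y (i + N)))"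
        by (rule sum.reindex_bij_witness[of _ "\<lambda>i. i + N" "\<lambda>j. j - N"]) (auto simp: J_def)
      also have "\<dots> = (\<Sum>i<N. indicat_real {..a} (\<phi> (merge I J (S, y) (i + N))))"
      proof (intro sum.cong refl)
        fix i assume "i \<in> {..<N}"
        then have "i + N \<in> J" "i + N \<notin> I" by (auto simp: I_def J_def)
        moreover from this have "y (i + N) \<in> space D" using ysp by (auto simp: space_PiM PiE_def Pi_def)
        ultimately show "indicat_real A (y (i + N)) = indicat_real {..a} (\<phi> (merge I J (S, y) (i + N)))"
          by (auto simp: A_def indicator_def merge_def)
      qed
      finally have "t * N / 2 + 2 * c \<phi> S \<le> (\<Sum>i<N. indicat_real {..a} (\<phi> (merge I J (S, y) (i + N))))"
        using pN by linarith
      moreover have "c \<phi> S = (\<Sum>i<N. indicator {..a + 2 * \<tau>} (\<phi> (merge I J (S, y) i)))"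
        unfolding c_def by (intro sum.cong refl) (auto simp: merge_def I_def)
      ultimately show ?thesis
        unfolding E_def using sp \<phi>(1) by (auto simp: s_def algebra_simps intro!: bexI[of _ \<phi>])
    qed
    then have "(\<integral>\<^sup>+ y. indicator ?G y \<partial>?Q) \<le> (\<integral>\<^sup>+ y. indicator E (merge I J (S, y)) \<partial>?Q)"
      by (intro nn_integral_mono) (simp split: split_indicator)
    then have "emeasure ?Q ?G \<le> (\<integral>\<^sup>+ y. indicator E (merge I J (S, y)) \<partial>?Q)"
      unfolding nn_integral_indicator[OF sG] .
    moreover have "ennreal (1 / 2) \<le> emeasure ?Q ?G"
      unfolding Q.emeasure_eq_measure using hc by (rule ennreal_leI)
    ultimately show ?thesis using True by (simp add: order_trans)
  qed simp
  have "ennreal (1 / 2) * emeasure ?P Bad = (\<integral>\<^sup>+ S. ennreal (1 / 2) * indicator Bad S \<partial>?P)"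
    using sBad by (simp add: nn_integral_cmult_indicator)
  also have "\<dots> \<le> (\<integral>\<^sup>+ S. \<integral>\<^sup>+ y. indicator E (merge I J (S, y)) \<partial>?Q \<partial>?P)"
    by (intro nn_integral_mono ghost)
  also have "\<dots> = (\<integral>\<^sup>+ \<omega>. indicator E \<omega> \<partial>?R)"
    using sE by (intro product_nn_integral_fold[symmetric] IJ(1-3)) auto
  also have "\<dots> = emeasure ?R E" using sE by simp
  finally have "ennreal (1 / 2 * measure ?P Bad) \<le> ennreal (measure ?R E)"
    unfolding P.emeasure_eq_measure R.emeasure_eq_measure by (subst ennreal_mult) auto
  then have "measure ?P Bad / 2 \<le> measure ?R E"
    by (subst (asm) ennreal_le_iff) auto
  then have mBad: "measure ?P Bad \<le> \<delta>" using mE by linarith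
  show thesis
  proof (rule that[of Bad])
    fix S \<phi> assume "S \<in> space (Pi\<^sub>M {..<N} (\<lambda>_. D))" "S \<notin> Bad" "\<phi> \<in> \<Phi>"
    then show "measure D {z \<in> space D. \<phi> z \<le> a} \<le> t + 4 * (\<Sum>i<N. indicator {..a + 2 * \<tau>} (\<phi> (S i))) / N"
      by (auto simp: Bad_def c_def p_def I_def not_less)
  qed (use sBad mBad in \<open>auto simp: I_def\<close>)
qed

section \<open>Ensembles\<close>

text \<open>A code consists of finitely many pairs of a basic open set and a rational value,
  together with a tolerance; there are countably many codes. Compactness gives every member of
  \<open>G\<close> a code at any tolerance, and two functions sharing a code differ by less than
  twice the tolerance. Choosing one member of \<open>G\<close> per realized code keeps the family
  inside \<open>G\<close>.\<close>

lemma countable_uniformly_dense: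
  fixes X :: "'a::{metric_space, second_countable_topology} set" and G :: "('a \<Rightarrow> real) set"
  assumes X: "compact X" and G: "\<And>f. f \<in> G \<Longrightarrow> continuous_on X f"
  obtains G0 where "countable G0" "G0 \<subseteq> G"
    "\<And>f \<eta>. f \<in> G \<Longrightarrow> 0 < \<eta> \<Longrightarrow> \<exists>g\<in>G0. \<forall>x\<in>X. \<bar>f x - g x\<bar> < \<eta>"
proof -
  obtain \<B> :: "'a set set" where \<B>: "countable \<B>" "topological_basis \<B>"
    using ex_countable_basis by blast
  define K where "K = {F. finite F \<and> F \<subseteq> \<B> \<times> (\<rat>::real set)} \<times> (UNIV :: nat set)"
  have K: "countable K"
    unfolding K_def by (intro countable_SIGMA countable_Collect_finite_subset \<B>(1) countable_rat) auto
  define P where "P k f \<longleftrightarrow> f \<in> G \<and> X \<subseteq> (\<Union>(U, q)\<in>fst k. U) \<and>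
    (\<forall>(U, q)\<in>fst k. \<forall>x\<in>U \<inter> X. \<bar>f x - q\<bar> < 1 / Suc (snd k))" for k :: "('a set \<times> real) set \<times> nat" and f
  define G0 where "G0 = (\<lambda>k. SOME f. P k f) ` {k \<in> K. \<exists>f. P k f}"
  have some: "P k (SOME f. P k f)" if "\<exists>f. P k f" for k using someI_ex[OF that] .
  show thesis
  proof (rule that)
    show "countable G0"
      unfolding G0_def by (intro countable_image countable_subset[OF _ K]) auto
    show "G0 \<subseteq> G" using some by (auto simp: G0_def P_def)
    fix f and \<eta> :: real assume f: "f \<in> G" and \<eta>: "0 < \<eta>"
    obtain n where n: "1 / real (Suc n) < \<eta> / 2"
      using nat_approx_posE[of "\<eta> / 2"] \<eta> by auto
    define \<epsilon> where "\<epsilon> = 1 / real (Suc n)"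
    have "\<epsilon> > 0" by (simp add: \<epsilon>_def)
    have "\<exists>U q. U \<in> \<B> \<and> q \<in> \<rat> \<and> x \<in> U \<and> (\<forall>y\<in>U \<inter> X. \<bar>f y - q\<bar> < \<epsilon>)" if x: "x \<in> X" for x
    proof -
      obtain q where q: "q \<in> \<rat>" "f x - \<epsilon> / 2 < q" "q < f x + \<epsilon> / 2"
        using Rats_dense_in_real[of "f x - \<epsilon> / 2" "f x + \<epsilon> / 2"] \<open>\<epsilon> > 0\<close> by auto
      obtain d where d: "d > 0" "\<And>y. y \<in> X \<Longrightarrow> dist y x < d \<Longrightarrow> dist (f y) (f x) < \<epsilon> / 2"
        using G[OF f] x \<open>\<epsilon> > 0\<close> unfolding continuous_on_iff by (metis half_gt_zero)
      obtain U where U: "U \<in> \<B>" "x \<in> U" "U \<subseteq> ball x d"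
        using topological_basisE[OF \<B>(2), of "ball x d" x] d(1) by auto
      have "\<bar>f y - q\<bar> < \<epsilon>" if "y \<in> U \<inter> X" for y
      proof -
        have "dist y x < d" using U(3) that by (auto simp: dist_commute)
        then have "\<bar>f y - f x\<bar> < \<epsilon> / 2" using d(2)[of y] that by (simp add: dist_real_def)
        then show ?thesis using q by linarith
      qed
      then show ?thesis using U q by blast
    qed
    then obtain U q where Uq: "\<And>x. x \<in> X \<Longrightarrow> U x \<in> \<B> \<and> q x \<in> \<rat> \<and> x \<in> U x \<and> (\<forall>y\<in>U x \<inter> X. \<bar>f y - q x\<bar> < \<epsilon>)"
      by metis
    obtain Y where Y: "Y \<subseteq> X" "finite Y" "X \<subseteq> (\<Union>x\<in>Y. U x)"
      using compactE_image[OF X, of X U] Uq topological_basis_open[OF \<B>(2)] by blast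
    define k where "k = ((\<lambda>x. (U x, q x)) ` Y, n)"
    have "k \<in> K" using Y Uq by (auto simp: K_def k_def)
    moreover have Pf: "P k f" using f Y Uq by (auto simp: P_def k_def \<epsilon>_def)
    ultimately have g: "(SOME f. P k f) \<in> G0" unfolding G0_def by blast
    have Pg: "P k (SOME f. P k f)" by (rule some) (use Pf in blast)
    have "\<bar>f x - (SOME f. P k f) x\<bar> < \<eta>" if x: "x \<in> X" for x
    proof -
      obtain y where y: "y \<in> Y" "x \<in> U y" using Y(3) x by blast
      have "\<bar>f x - q y\<bar> < \<epsilon>" "\<bar>(SOME f. P k f) x - q y\<bar> < \<epsilon>"
        using Pf Pg y x unfolding P_def k_def \<epsilon>_def by auto
      then show ?thesis using n unfolding \<epsilon>_def by linarith
    qed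
    then show "\<exists>g\<in>G0. \<forall>x\<in>X. \<bar>f x - g x\<bar> < \<eta>" using g by blast
  qed
qed

section \<open>Ensembles of a class with polynomial covering numbers\<close>

locale uniform_entropy_class =
  fixes X :: "('a::euclidean_space) set" and \<Theta> :: "('p::euclidean_space) set"
    and h :: "'p \<Rightarrow> 'a \<Rightarrow> real" and C V :: real
  assumes h_range: "\<And>\<theta> x. \<theta> \<in> \<Theta> \<Longrightarrow> x \<in> X \<Longrightarrow> h \<theta> x \<in> {-1..1}"
    and h_measurable: "(\<lambda>(\<theta>, x). h \<theta> x) \<in> borel_measurable (restrict_space borel (\<Theta> \<times> X))"
    and h_continuous: "\<And>\<theta>. \<theta> \<in> \<Theta> \<Longrightarrow> continuous_on X (h \<theta>)"
    and C: "C > 1"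
    and V: "V > 0"
    and covering: "\<And>\<epsilon>. \<epsilon> \<in> {0<..<1} \<Longrightarrow>
      (SUP m\<in>discrete_probs_on X.
         ereal_of_enat (covering_number (measure_pmf m) \<epsilon> (base_classifiers h \<Theta>)))
      \<le> ereal (C * \<epsilon> powr (- V))"
begin

lemma abs_h_le: "\<theta> \<in> \<Theta> \<Longrightarrow> x \<in> X \<Longrightarrow> \<bar>h \<theta> x\<bar> \<le> 1"
  using h_range[of \<theta> x] by (simp add: abs_le_iff)

lemma borel_prob_measuresD:
  assumes "\<mu> \<in> borel_prob_measures \<Theta>"
  shows "prob_space \<mu>" "space \<mu> = \<Theta>" "x \<in> X \<Longrightarrow> (\<lambda>\<theta>. h \<theta> x) \<in> borel_measurable \<mu>"
proof -
  have s: "sets \<mu> = sets (restrict_space borel \<Theta>)" and "prob_space \<mu>"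
    using assms by (auto simp: borel_prob_measures_def)
  then show "prob_space \<mu>" by simp
  show "space \<mu> = \<Theta>" using sets_eq_imp_space_eq[OF s] by (simp add: space_restrict_space)
  show "(\<lambda>\<theta>. h \<theta> x) \<in> borel_measurable \<mu>" if x: "x \<in> X"
  proof -
    have "(\<lambda>\<theta>. (\<theta>, x)) \<in> measurable (restrict_space borel \<Theta>) (restrict_space borel (\<Theta> \<times> X))"
      using x by (intro measurable_restrict_space3) (auto intro!: borel_measurable_continuous_onI continuous_intros)
    from measurable_compose[OF this h_measurable] show ?thesis
      by (simp add: measurable_cong_sets[OF s refl])
  qed
qed

text \<open>Dominated convergence, the base classifiers being continuous and bounded by 1 on
  \<open>X\<close>.\<close>

lemma continuous_on_ensemble:
  assumes "f \<in> ensembles h \<Theta>"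
  shows "continuous_on X f"
proof -
  obtain \<mu> where \<mu>: "\<mu> \<in> borel_prob_measures \<Theta>" "f = ensemble h \<mu>"
    using assms by (auto simp: ensembles_def)
  note \<mu>' = borel_prob_measuresD[OF \<mu>(1)]
  interpret prob_space \<mu> by (rule \<mu>'(1))
  show ?thesis
    unfolding continuous_on_sequentially
  proof (intro allI ballI impI, elim conjE)
    fix u :: "nat \<Rightarrow> 'a" and x assume x: "x \<in> X" and u: "\<forall>n. u n \<in> X" "u \<longlonglongrightarrow> x"
    have "(\<lambda>n. \<integral>\<theta>. h \<theta> (u n) \<partial>\<mu>) \<longlonglongrightarrow> (\<integral>\<theta>. h \<theta> x \<partial>\<mu>)"
    proof (rule integral_dominated_convergence[where w="\<lambda>_. 1"])
      show "AE \<theta> in \<mu>. (\<lambda>n. h \<theta> (u n)) \<longlonglongrightarrow> h \<theta> x"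
      proof (rule AE_I2)
        fix \<theta> assume "\<theta> \<in> space \<mu>"
        then show "(\<lambda>n. h \<theta> (u n)) \<longlonglongrightarrow> h \<theta> x"
          using x u \<mu>'(2) by (intro continuous_on_tendsto_compose[OF h_continuous]) auto
      qed
      show "AE \<theta> in \<mu>. norm (h \<theta> (u n)) \<le> 1" for n
        using abs_h_le u(1) \<mu>'(2) by (intro AE_I2) auto
    qed (use \<mu>'(3) x u(1) in auto)
    then show "(f \<circ> u) \<longlonglongrightarrow> f x" unfolding \<mu>(2) ensemble_def o_def .
  qed
qed

text \<open>The discrete measure to use is the empirical measure of the points \<open>xs\<close>,
  repetitions counted: its \<open>L2_norm\<close> is the Euclidean norm of the vector of values
  divided by \<open>sqrt m\<close>.\<close>

lemma base_net:
  fixes m :: nat and xs :: "nat \<Rightarrow> 'a"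
  assumes m: "m > 0" and xs: "\<And>i. i < m \<Longrightarrow> xs i \<in> X" and \<epsilon>: "\<epsilon> \<in> {0<..<1}"
  shows "\<exists>A. finite A \<and> real (card A) \<le> C * \<epsilon> powr (- V) \<and>
    (\<forall>\<theta>\<in>\<Theta>. \<exists>a\<in>A. L2_set (\<lambda>i. h \<theta> (xs i) - a i) {..<m} \<le> \<epsilon> * sqrt m)"
proof -
  define p where "p = map_pmf xs (pmf_of_set {..<m})"
  have ne: "{..<m} \<noteq> {}" "finite {..<m}" using m by auto
  have "set_pmf p \<subseteq> X" using xs ne by (auto simp: p_def)
  then have "p \<in> discrete_probs_on X" by (simp add: discrete_probs_on_def)
  then have le: "ereal_of_enat (covering_number (measure_pmf p) \<epsilon> (base_classifiers h \<Theta>)) \<le> ereal (C * \<epsilon> powr (- V))"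
    by (intro order_trans[OF SUP_upper covering[OF \<epsilon>]])
  define S where "S = {enat (card A) | A. finite A \<and> A \<subseteq> L2_functions (measure_pmf p) \<and>
      base_classifiers h \<Theta> \<subseteq> (\<Union>g\<in>A. L2_ball (measure_pmf p) g \<epsilon>)}"
  have cov: "covering_number (measure_pmf p) \<epsilon> (base_classifiers h \<Theta>) = Inf S"
    by (simp add: covering_number_def S_def)
  \<comment> \<open>A finite infimum of extended naturals is attained, which provides an actual
    cover of that size.\<close>
  have "Inf S \<noteq> \<infinity>" using le unfolding cov by (cases "Inf S") auto
  then have "S \<noteq> {}" by (auto simp: Inf_enat_def)
  then have "Inf S \<in> S" unfolding Inf_enat_def by (auto intro: LeastI)
  then obtain A where A: "Inf S = enat (card A)" "finite A"
      "base_classifiers h \<Theta> \<subseteq> (\<Union>g\<in>A. L2_ball (measure_pmf p) g \<epsilon>)"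
    by (auto simp: S_def)
  have cA: "real (card A) \<le> C * \<epsilon> powr (- V)" using le unfolding cov A(1) by simp
  define A' where "A' = (\<lambda>g i. g (xs i)) ` A"
  have "card A' \<le> card A" unfolding A'_def using A(2) by (rule card_image_le)
  then have "real (card A') \<le> C * \<epsilon> powr (- V)" using cA by linarith
  moreover have "\<exists>a\<in>A'. L2_set (\<lambda>i. h \<theta> (xs i) - a i) {..<m} \<le> \<epsilon> * sqrt m" if \<theta>: "\<theta> \<in> \<Theta>" for \<theta>
  proof -
    have "h \<theta> \<in> base_classifiers h \<Theta>" using \<theta> by (auto simp: base_classifiers_def)
    then obtain g where g: "g \<in> A" "L2_norm (measure_pmf p) (\<lambda>x. h \<theta> x - g x) < \<epsilon>"
      using A(3) by (auto simp: L2_ball_def)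
    have "L2_norm (measure_pmf p) (\<lambda>x. h \<theta> x - g x) = L2_set (\<lambda>i. h \<theta> (xs i) - g (xs i)) {..<m} / sqrt m"
      unfolding L2_norm_def p_def L2_set_def using ne
      by (simp add: integral_pmf_of_set real_sqrt_divide)
    then have "L2_set (\<lambda>i. h \<theta> (xs i) - g (xs i)) {..<m} \<le> \<epsilon> * sqrt m"
      using g(2) m by (simp add: divide_less_eq)
    then show ?thesis using g(1) by (auto simp: A'_def)
  qed
  moreover have "finite A'" using A(2) by (simp add: A'_def)
  ultimately show ?thesis by blast
qed

text \<open>A further application of \<open>maurey\<close> replaces the arbitrary
  \<open>\<mu>\<close> by a uniform average of \<open>s\<close> base classifiers, to which
  \<open>means_cover_entropy\<close> applies. The cover there does not depend on \<open>s\<close>,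
  so \<open>s\<close> can be taken large enough for any accuracy at no cost in entropy; the
  additional error turns \<open>K2\<close> into \<open>K2 + 1\<close>.\<close>

lemma ensembles_entropy:
  obtains K1 K2 where "K1 > 0" "K2 > 0"
    "\<And>m xs J. m > 0 \<Longrightarrow> (\<And>i. i < m \<Longrightarrow> xs i \<in> X) \<Longrightarrow>
      \<exists>B. finite B \<and> real (card B) \<le> exp (K1 * 2 powr (real J * V)) \<and>
        (\<forall>f\<in>ensembles h \<Theta>. \<exists>b\<in>B. L2_set (\<lambda>i. f (xs i) - b i) {..<m}
          \<le> K2 * 2 powr (- real J * (1 + V / 2)) * sqrt (real m))"
proof (rule means_cover_entropy[where ?'i=nat and ?'t=nat, OF less_imp_le[OF C] V], goal_cases)
  case (1 K1 K2)
  note K = 1(2,3) and main = 1(4)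
  show thesis
  proof (rule 1(1)[of K1 "K2 + 1"])
    fix m J :: nat and xs :: "nat \<Rightarrow> 'a" assume m: "m > 0" and xs: "\<And>i. i < m \<Longrightarrow> xs i \<in> X"
    define H where "H = (\<lambda>\<theta> i. h \<theta> (xs i)) ` \<Theta>"
    have bnd: "L2_set (\<lambda>i. h \<theta> (xs i)) {..<m} \<le> sqrt m" if "\<theta> \<in> \<Theta>" for \<theta>
    proof -
      have "(\<Sum>i<m. (h \<theta> (xs i))\<^sup>2) \<le> (\<Sum>i<m. 1)"
        using abs_h_le[OF that xs] by (intro sum_mono) (auto simp: abs_square_le_1)
      then show ?thesis by (simp add: L2_set_def)
    qed
    have Hb: "\<And>f. f \<in> H \<Longrightarrow> L2_set f {..<m} \<le> sqrt m" using bnd by (auto simp: H_def)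
    have nets: "\<exists>A. finite A \<and> real (card A) \<le> C * 2 powr (real j * V) \<and>
        (\<forall>f\<in>H. \<exists>a\<in>A. L2_set (\<lambda>i. f i - a i) {..<m} \<le> (1/2) ^ j * sqrt m)" if j: "j > 0" for j :: nat
    proof -
      have "(1/2::real) ^ j \<in> {0<..<1}" using j by (simp add: power_less_one_iff)
      moreover have "((1/2::real) ^ j) powr (- V) = 2 powr (real j * V)"
        by (simp add: power_one_over powr_minus_divide powr_realpow[symmetric] powr_powr powr_divide)
      ultimately show ?thesis
        using base_net[where xs=xs and \<epsilon>="(1/2) ^ j", OF m xs] by (simp add: H_def)
    qed
    obtain B where B: "finite B" "real (card B) \<le> exp (K1 * 2 powr (real J * V))"
      "\<And>(q::nat pmf) w. (\<And>t. w t \<in> H) \<Longrightarrow>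
          \<exists>b\<in>B. L2_set (\<lambda>i. measure_pmf.expectation q (\<lambda>t. w t i) - b i) {..<m}
            \<le> K2 * 2 powr (- real J * (1 + V / 2)) * sqrt m"
      using main[of "{..<m}" "sqrt m" H J, OF finite_lessThan real_sqrt_ge_zero[OF of_nat_0_le_iff] Hb nets]
      by blast
    have "\<exists>b\<in>B. L2_set (\<lambda>i. f (xs i) - b i) {..<m}
          \<le> (K2 + 1) * 2 powr (- real J * (1 + V / 2)) * sqrt m" if f: "f \<in> ensembles h \<Theta>" for f
    proof -
      obtain \<mu> where \<mu>: "\<mu> \<in> borel_prob_measures \<Theta>" "f = ensemble h \<mu>"
        using f by (auto simp: ensembles_def)
      note \<mu>' = borel_prob_measuresD[OF \<mu>(1)]
      define \<epsilon> where "\<epsilon> = (2::real) powr (- real J * (1 + V / 2))"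
      have "\<epsilon> > 0" by (simp add: \<epsilon>_def)
      obtain s :: nat where s: "s > 0" "1 / \<epsilon>\<^sup>2 \<le> real s"
        using real_arch_simple[of "1 / \<epsilon>\<^sup>2"] \<open>\<epsilon> > 0\<close> by (metis divide_pos_pos less_le_trans of_nat_0_less_iff zero_less_one zero_less_power)
      have "1 / \<epsilon> \<le> sqrt (real s)"
        using real_sqrt_le_mono[OF s(2)] \<open>\<epsilon> > 0\<close> by (simp add: real_sqrt_divide)
      then have s2: "sqrt m / sqrt s \<le> \<epsilon> * sqrt m"
        using s(1) \<open>\<epsilon> > 0\<close> mult_right_mono[of "1 / \<epsilon>" "sqrt s" "sqrt m * \<epsilon>"] by (simp add: field_simps)
      obtain \<tau> where \<tau>: "\<forall>k<s. \<tau> k \<in> \<Theta>"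
        "L2_set (\<lambda>i. (\<integral>\<theta>. h \<theta> (xs i) \<partial>\<mu>) - (\<Sum>k<s. h (\<tau> k) (xs i)) / real s) {..<m} \<le> sqrt m / sqrt s"
        using maurey[OF \<mu>'(1), of "{..<m}" "\<lambda>\<theta> i. h \<theta> (xs i)" "sqrt m" s] \<mu>'(2,3) xs bnd s(1) by auto
      \<comment> \<open>Indices from \<open>s\<close> on are padded with \<open>\<tau> 0\<close> so
        that \<open>w\<close> takes values in \<open>H\<close> everywhere; the uniform distribution
        on \<open>{..<s}\<close> does not see them.\<close>
      define w where "w t = (\<lambda>i. h (\<tau> (if t < s then t else 0)) (xs i))" for t
      have w: "w t \<in> H" for t using \<tau>(1) s(1) by (auto simp: w_def H_def)
      have avg: "measure_pmf.expectation (pmf_of_set {..<s}) (\<lambda>t. w t i) = (\<Sum>k<s. h (\<tau> k) (xs i)) / real s" for i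
        using s(1) by (subst integral_pmf_of_set) (auto simp: w_def lessThan_empty_iff)
      obtain b where b: "b \<in> B" "L2_set (\<lambda>i. (\<Sum>k<s. h (\<tau> k) (xs i)) / real s - b i) {..<m} \<le> K2 * \<epsilon> * sqrt m"
        using B(3)[where w=w and q="pmf_of_set {..<s}", OF w] unfolding avg \<epsilon>_def by blast
      have "L2_set (\<lambda>i. f (xs i) - b i) {..<m} \<le>
         L2_set (\<lambda>i. (\<integral>\<theta>. h \<theta> (xs i) \<partial>\<mu>) - (\<Sum>k<s. h (\<tau> k) (xs i)) / real s) {..<m} +
         L2_set (\<lambda>i. (\<Sum>k<s. h (\<tau> k) (xs i)) / real s - b i) {..<m}"
        unfolding \<mu>(2) ensemble_def by (rule order_trans[OF _ L2_set_triangle_ineq]) simp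
      also have "\<dots> \<le> (K2 + 1) * \<epsilon> * sqrt m" using \<tau>(2) b(2) s2 by (simp add: algebra_simps)
      finally show ?thesis using b(1) unfolding \<epsilon>_def by blast
    qed
    then show "\<exists>B. finite B \<and> real (card B) \<le> exp (K1 * 2 powr (real J * V)) \<and>
        (\<forall>f\<in>ensembles h \<Theta>. \<exists>b\<in>B. L2_set (\<lambda>i. f (xs i) - b i) {..<m}
          \<le> (K2 + 1) * 2 powr (- real J * (1 + V / 2)) * sqrt (real m))"
      using B(1,2) by blast
  qed (use K in auto)
qed

end

section \<open>The margin bound\<close>

definition margin_rate :: "real \<Rightarrow> nat \<Rightarrow> real \<Rightarrow> real" where
  "margin_rate V N \<rho> = \<rho> powr (- V / (V + 1)) * real N powr (- (V + 2) / (2 * (V + 1)))"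

text \<open>The exponent of \<open>N\<close> is at least \<open>- 1\<close>. The power of
  \<open>\<rho>\<close> is kept because its growth for small margins later absorbs the cost of a
  union bound over dyadic margins.\<close>

lemma margin_rate_ge:
  assumes "V > 0" "N \<ge> 1" "0 < \<rho>"
  shows "\<rho> powr (- V / (V + 1)) / N \<le> margin_rate V N \<rho>"
proof -
  have "real N powr (- 1) \<le> real N powr (- (V + 2) / (2 * (V + 1)))"
    using assms by (intro powr_mono) (auto simp: field_simps)
  then have "1 / N \<le> real N powr (- (V + 2) / (2 * (V + 1)))"
    using assms by (simp add: powr_minus_divide)
  from mult_left_mono[OF this, of "\<rho> powr (- V / (V + 1))"] show ?thesis
    by (simp add: margin_rate_def)
qed

lemma margin_rate_ge_inverse:
  assumes "V > 0" "N \<ge> 1" "0 < \<rho>" "\<rho> \<le> 1"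
  shows "1 / N \<le> margin_rate V N \<rho>"
proof -
  have "1 \<le> \<rho> powr (- V / (V + 1))"
    using powr_mono2'[of "- V / (V + 1)" \<rho> 1] assms by simp
  then have "1 / N \<le> \<rho> powr (- V / (V + 1)) / N" by (intro divide_right_mono) auto
  then show ?thesis using margin_rate_ge[of V N \<rho>] assms by linarith
qed

lemma margin_rate_double:
  assumes "V > 0" "0 < \<rho>" "\<rho> \<le> 2 * \<rho>'"
  shows "margin_rate V N \<rho>' \<le> 2 * margin_rate V N \<rho>"
proof -
  define v where "v = V / (V + 1)"
  have v: "0 \<le> v" "v \<le> 1" using assms by (auto simp: v_def)
  have "\<rho>' powr (- v) \<le> (\<rho> / 2) powr (- v)" using assms v by (intro powr_mono2') auto
  also have "\<dots> = \<rho> powr (- v) * 2 powr v" using assms by (simp add: powr_divide powr_minus field_simps)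
  also have "\<dots> \<le> \<rho> powr (- v) * 2" using powr_mono[of v 1 2] v by (intro mult_left_mono) auto
  finally have "\<rho>' powr (- v) \<le> 2 * \<rho> powr (- v)" by simp
  from mult_right_mono[OF this, of "real N powr (- (V + 2) / (2 * (V + 1)))"] show ?thesis
    by (simp add: margin_rate_def v_def)
qed

text \<open>The resolution \<open>2 powr (- J)\<close> balances the entropy per observation against the fraction of
  points on which the approximation may be off by more than \<open>\<rho>\<close>; both are then of the order of
  \<open>margin_rate V N \<rho>\<close>.\<close>

lemma margin_rate_resolution:
  assumes V: "V > 0" and N: "N \<ge> 1" and \<rho>: "0 < \<rho>" "\<rho> \<le> 1"
  obtains J :: nat where "2 powr (real J * V) / N \<le> 2 powr V * margin_rate V N \<rho>"
    "2 powr (- real J * (V + 2)) / \<rho>\<^sup>2 \<le> margin_rate V N \<rho>"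
proof -
  define e where "e = 1 / (2 * (V + 1))"
  \<comment> \<open>This solves \<open>u powr V / N = u powr (- (V + 2)) / \<rho>\<^sup>2\<close>.
    Rounding \<open>log 2 u\<close> up to \<open>J\<close> costs the factor \<open>2 powr V\<close>
    on the left and nothing on the right.\<close>
  define u where "u = (real N / \<rho>\<^sup>2) powr e"
  have "1 * \<rho>\<^sup>2 \<le> real N * 1" using N \<rho> by (intro mult_mono power_le_one) auto
  then have "1 \<le> real N / \<rho>\<^sup>2" using \<rho> by (simp add: le_divide_eq)
  then have u1: "u \<ge> 1" unfolding u_def e_def using V by (intro ge_one_powr_ge_zero) auto
  have u_powr: "u powr x = real N powr (e * x) * \<rho> powr (- 2 * e * x)" for x
    using N \<rho> by (simp add: u_def powr_powr powr_divide powr_minus field_simps flip: powr_numeral)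
  define J where "J = nat \<lceil>log 2 u\<rceil>"
  have "log 2 u \<ge> 0" using u1 by simp
  then have J: "log 2 u \<le> real J" "real J \<le> log 2 u + 1" unfolding J_def by linarith+
  show thesis
  proof (rule that[of J])
    have "2 powr (real J * V) \<le> 2 powr ((log 2 u + 1) * V)"
      using J V by (intro powr_mono mult_right_mono) auto
    also have "\<dots> = u powr V * 2 powr V"
      using u1 by (simp add: distrib_right powr_add powr_powr[symmetric])
    finally have "2 powr (real J * V) / N \<le> u powr V * 2 powr V / N"
      by (intro divide_right_mono) auto
    also have "\<dots> = 2 powr V * (\<rho> powr (- 2 * e * V) * real N powr (e * V - 1))"
      using N unfolding u_powr by (simp add: powr_diff field_simps)
    also have "- 2 * e * V = - V / (V + 1)" using V by (simp add: e_def field_simps)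
    also have "e * V - 1 = - (V + 2) / (2 * (V + 1))" using V by (simp add: e_def field_simps)
    finally show "2 powr (real J * V) / N \<le> 2 powr V * margin_rate V N \<rho>" by (simp add: margin_rate_def)
    have "- real J * (V + 2) \<le> log 2 u * (- (V + 2))"
      using mult_right_mono[OF J(1), of "V + 2"] V by (simp only: mult_minus_left mult_minus_right neg_le_iff_le)
    then have "2 powr (- real J * (V + 2)) \<le> 2 powr (log 2 u * (- (V + 2)))"
      by (intro powr_mono) auto
    also have "\<dots> = u powr (- (V + 2))" using u1 by (simp only: powr_powr[symmetric] powr_log_cancel)
    finally have "2 powr (- real J * (V + 2)) / \<rho>\<^sup>2 \<le> u powr (- (V + 2)) / \<rho>\<^sup>2"
      by (intro divide_right_mono) auto
    also have "\<dots> = \<rho> powr (- 2 * e * (- (V + 2)) - 2) * real N powr (e * (- (V + 2)))"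
      using \<rho> unfolding u_powr by (simp only: powr_diff) (simp add: field_simps)
    also have "- 2 * e * (- (V + 2)) - 2 = - V / (V + 1)" using V by (simp add: e_def field_simps)
    also have "e * (- (V + 2)) = - (V + 2) / (2 * (V + 1))" using V by (simp add: e_def field_simps)
    finally show "2 powr (- real J * (V + 2)) / \<rho>\<^sup>2 \<le> margin_rate V N \<rho>" by (simp add: margin_rate_def)
  qed
qed

section \<open>Empirical counts and dyadic margins\<close>

lemma card_deviation_le:
  fixes d :: "'i \<Rightarrow> real"
  assumes "finite I" "\<tau> > 0"
  shows "real (card {i\<in>I. \<tau> < \<bar>d i\<bar>}) \<le> (L2_set d I)\<^sup>2 / \<tau>\<^sup>2"
proof -
  have "real (card {i\<in>I. \<tau> < \<bar>d i\<bar>}) * \<tau>\<^sup>2 = (\<Sum>i\<in>{i\<in>I. \<tau> < \<bar>d i\<bar>}. \<tau>\<^sup>2)" by simp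
  also have "\<dots> \<le> (\<Sum>i\<in>{i\<in>I. \<tau> < \<bar>d i\<bar>}. (d i)\<^sup>2)"
    using assms by (intro sum_mono) (auto simp: abs_le_square_iff[symmetric])
  also have "\<dots> \<le> (\<Sum>i\<in>I. (d i)\<^sup>2)" using assms by (intro sum_mono2) auto
  also have "\<dots> = (L2_set d I)\<^sup>2" by (simp add: L2_set_def sum_nonneg)
  finally show ?thesis using assms by (simp add: field_simps)
qed

lemma empirical_prob:
  assumes "N > 0"
  shows "\<P>(z in measure_pmf (empirical_pmf N S). P z) = (\<Sum>i<N. of_bool (P (S i))) / N"
proof -
  have "\<P>(z in measure_pmf (empirical_pmf N S). P z) = measure (measure_pmf (pmf_of_set {..<N})) {i. P (S i)}"
    by (simp add: empirical_pmf_def vimage_def)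
  also have "\<dots> = real (card ({..<N} \<inter> {i. P (S i)})) / real (card {..<N})"
    using assms by (intro measure_pmf_of_set) (auto simp: lessThan_empty_iff)
  finally show ?thesis by (simp add: sum.If_cases of_bool_def)
qed

lemma dyadic_approximation:
  fixes \<rho> :: real
  assumes "0 < \<rho>" "\<rho> \<le> 1"
  obtains k :: nat where "(1/2) ^ k \<le> \<rho>" "\<rho> \<le> 2 * (1/2) ^ k"
proof -
  define k where "k = (LEAST k. (1/2::real) ^ k \<le> \<rho>)"
  obtain n where "(1/2::real) ^ n \<le> \<rho>"
    using real_arch_pow_inv[of \<rho> "1/2"] assms by (auto intro: less_imp_le)
  then have k: "(1/2::real) ^ k \<le> \<rho>" unfolding k_def by (rule LeastI)
  have "\<rho> \<le> 2 * (1/2) ^ k"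
  proof (cases k)
    case 0
    then show ?thesis using assms by simp
  next
    case (Suc m)
    then have "\<not> (1/2::real) ^ m \<le> \<rho>" unfolding k_def by (metis lessI not_less_Least)
    then show ?thesis using Suc by simp
  qed
  with k that show thesis by blast
qed

section \<open>Deviation bound at one margin\<close>

context uniform_entropy_class
begin

text \<open>This is \<open>relative_deviation_bound\<close> with \<open>a\<close> and
  \<open>\<tau>\<close> both equal to \<open>\<rho> / 4\<close>. The thresholds
  \<open>\<rho> / 4\<close> and \<open>3 * \<rho> / 4\<close> leave a gap of
  \<open>\<rho> / 4\<close> to 0 and to \<open>\<rho>\<close>, reserved for the passage from
  \<open>G\<close> to all ensembles.\<close>

lemma margin_bound_fixed_level:
  fixes D :: "('a \<times> real) measure"
  assumes D: "D \<in> borel_prob_measures (X \<times> {-1, 1})" and G: "countable G" "G \<subseteq> ensembles h \<Theta>"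
  shows "\<exists>K>0. \<forall>N\<ge>1. \<forall>\<rho> \<delta>. 0 < \<rho> \<longrightarrow> \<rho> \<le> 1 \<longrightarrow> 0 < \<delta> \<longrightarrow> \<delta> < 1 \<longrightarrow>
    (\<exists>Bad\<in>sets (sample_measure N D). measure (sample_measure N D) Bad \<le> \<delta> \<and>
      (\<forall>S\<in>space (sample_measure N D) - Bad. \<forall>g\<in>G.
        \<P>(z in D. snd z * g (fst z) \<le> \<rho> / 4) \<le> K * (margin_rate V N \<rho> + ln (1 / \<delta>) / N)
          + 4 * (\<Sum>i<N. indicator {..3 * \<rho> / 4} (snd (S i) * g (fst (S i)))) / N))"
proof -
  have s: "sets D = sets (restrict_space borel (X \<times> {-1, 1}))" and P: "prob_space D"
    using D by (auto simp: borel_prob_measures_def)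
  have sp: "space D = X \<times> {-1, 1}" using sets_eq_imp_space_eq[OF s] by (simp add: space_restrict_space)
  define \<phi> where "\<phi> g z = snd z * g (fst z)" for g :: "'a \<Rightarrow> real" and z :: "'a \<times> real"
  have meas: "\<phi> g \<in> borel_measurable D" if "g \<in> ensembles h \<Theta>" for g
  proof -
    have "continuous_on (X \<times> {-1, 1}) (\<lambda>z. snd z * g (fst z))"
      by (intro continuous_intros continuous_on_compose2[OF continuous_on_ensemble[OF that]]) auto
    from borel_measurable_continuous_on_restrict[OF this] show ?thesis
      unfolding \<phi>_def[abs_def] by (simp add: measurable_cong_sets[OF s refl])
  qed
  show ?thesis
  proof (rule ensembles_entropy, goal_cases)
    case (1 K1 K2)
    \<comment> \<open>The first term is \<open>6 * 2 * 16\<close> times \<open>K2\<^sup>2\<close>,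
      from \<open>6 * k / N\<close>; the second comes from the entropy; 14 collects the multiples 6
      and 8 of \<open>1 / N\<close> in \<open>t\<close>.\<close>
    define K where "K = 192 * K2\<^sup>2 + 6 * K1 * 2 powr V + 14"
    have "K > 0" unfolding K_def using 1(1) by (intro add_nonneg_pos) auto
    moreover have "\<exists>Bad\<in>sets (sample_measure N D). measure (sample_measure N D) Bad \<le> \<delta> \<and>
      (\<forall>S\<in>space (sample_measure N D) - Bad. \<forall>g\<in>G.
        \<P>(z in D. snd z * g (fst z) \<le> \<rho> / 4) \<le> K * (margin_rate V N \<rho> + ln (1 / \<delta>) / N)
          + 4 * (\<Sum>i<N. indicator {..3 * \<rho> / 4} (snd (S i) * g (fst (S i)))) / N)"
      if N: "N \<ge> 1" and \<rho>: "0 < \<rho>" "\<rho> \<le> 1" and \<delta>: "0 < \<delta>" "\<delta> < 1" for N :: nat and \<rho> \<delta> :: real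
    proof -
      obtain J :: nat where J: "2 powr (real J * V) / N \<le> 2 powr V * margin_rate V N \<rho>"
          "2 powr (- real J * (V + 2)) / \<rho>\<^sup>2 \<le> margin_rate V N \<rho>"
        using margin_rate_resolution[OF V N \<rho>] .
      define \<epsilon> where "\<epsilon> = K1 * 2 powr (real J * V)"
      \<comment> \<open>Chebyshev's count: the squared \<open>L2_set\<close> error on
        \<open>2 * N\<close> points divided by the squared tolerance
        \<open>\<rho> / 4\<close>.\<close>
      define k where "k = K2\<^sup>2 * 2 powr (- real J * (V + 2)) * (2 * N) / (\<rho> / 4)\<^sup>2"
      \<comment> \<open>After halving, \<open>6 * k\<close> cancels the loss \<open>3 * k\<close>,
        and the factor 6 of the second term becomes 3, which \<open>ln (3 / 2) \<ge> 1 / 3\<close>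
        compensates; its \<open>+ 1\<close> bounds \<open>ln 2\<close>. The term
        \<open>8 / N\<close> secures \<open>8 \<le> t * N\<close>.\<close>
      define t where "t = 6 * k / N + 6 * (\<epsilon> + 1 + ln (1 / \<delta>)) / N + 8 / N"
      have \<epsilon>0: "\<epsilon> \<ge> 0" and k0: "k \<ge> 0" using 1(1) by (auto simp: \<epsilon>_def k_def)
      have l0: "ln (1 / \<delta>) \<ge> 0" using \<delta> by simp
      have tN: "t * N = 6 * k + 6 * (\<epsilon> + 1 + ln (1 / \<delta>)) + 8"
        using N by (simp add: t_def field_simps)
      have cover: "\<exists>B. finite B \<and> real (card B) \<le> exp \<epsilon> \<and>
          (\<forall>\<phi>\<in>\<phi> ` G. \<exists>b\<in>B. real (card {i\<in>{..<2 * N}. \<rho> / 4 < \<bar>\<phi> (\<omega> i) - b i\<bar>}) \<le> k)"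
        if \<omega>: "\<omega> \<in> space (Pi\<^sub>M {..<2 * N} (\<lambda>_. D))" for \<omega>
      proof -
        have \<omega>D: "fst (\<omega> i) \<in> X" "\<bar>snd (\<omega> i)\<bar> = 1" if "i < 2 * N" for i
          using \<omega> that by (auto simp: space_PiM PiE_def Pi_def sp mem_Times_iff)
        obtain B where B: "finite B" "real (card B) \<le> exp \<epsilon>"
          "\<And>f. f \<in> ensembles h \<Theta> \<Longrightarrow> \<exists>b\<in>B. L2_set (\<lambda>i. f (fst (\<omega> i)) - b i) {..<2 * N}
            \<le> K2 * 2 powr (- real J * (1 + V / 2)) * sqrt (real (2 * N))"
          using 1(3)[of "2 * N" "\<lambda>i. fst (\<omega> i)" J] N \<omega>D(1) unfolding \<epsilon>_def by auto
        \<comment> \<open>Labels have absolute value 1, so multiplying by them turns a net for the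
          ensembles into one for the margins without changing any deviation.\<close>
        define B' where "B' = (\<lambda>b i. snd (\<omega> i) * b i) ` B"
        have "card B' \<le> card B" unfolding B'_def using B(1) by (rule card_image_le)
        then have "real (card B') \<le> exp \<epsilon>" using B(2) by linarith
        moreover have "\<exists>b\<in>B'. real (card {i\<in>{..<2 * N}. \<rho> / 4 < \<bar>\<phi> g (\<omega> i) - b i\<bar>}) \<le> k"
          if g: "g \<in> G" for g
        proof -
          obtain b where b: "b \<in> B" "L2_set (\<lambda>i. g (fst (\<omega> i)) - b i) {..<2 * N}
              \<le> K2 * 2 powr (- real J * (1 + V / 2)) * sqrt (real (2 * N))"
            using B(3) g G(2) by blast
          have "{i\<in>{..<2 * N}. \<rho> / 4 < \<bar>\<phi> g (\<omega> i) - snd (\<omega> i) * b i\<bar>}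
              = {i\<in>{..<2 * N}. \<rho> / 4 < \<bar>g (fst (\<omega> i)) - b i\<bar>}"
            using \<omega>D(2) by (auto simp: \<phi>_def abs_mult simp flip: right_diff_distrib)
          then have "real (card {i\<in>{..<2 * N}. \<rho> / 4 < \<bar>\<phi> g (\<omega> i) - snd (\<omega> i) * b i\<bar>})
              = real (card {i\<in>{..<2 * N}. \<rho> / 4 < \<bar>g (fst (\<omega> i)) - b i\<bar>})" by (rule arg_cong)
          also have "real (card {i\<in>{..<2 * N}. \<rho> / 4 < \<bar>g (fst (\<omega> i)) - b i\<bar>})
              \<le> (L2_set (\<lambda>i. g (fst (\<omega> i)) - b i) {..<2 * N})\<^sup>2 / (\<rho> / 4)\<^sup>2"
            using \<rho> by (intro card_deviation_le) auto
          also have "\<dots> \<le> (K2 * 2 powr (- real J * (1 + V / 2)) * sqrt (real (2 * N)))\<^sup>2 / (\<rho> / 4)\<^sup>2"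
            using b(2) by (intro divide_right_mono power_mono) auto
          also have "\<dots> = k"
          proof -
            have "(2 powr (- real J * (1 + V / 2)))\<^sup>2 = (2::real) powr (- real J * (V + 2))"
            proof -
              have "(2 powr (- real J * (1 + V / 2)))\<^sup>2 = (2::real) powr (2 * (- real J * (1 + V / 2)))"
                by (simp add: powr_power)
              also have "2 * (- real J * (1 + V / 2)) = - real J * (V + 2)" by (simp add: algebra_simps)
              finally show ?thesis .
            qed
            then show ?thesis unfolding k_def power_mult_distrib by simp
          qed
          finally show ?thesis using b(1) unfolding B'_def by (intro bexI[OF _ imageI])
        qed
        ultimately show ?thesis using B(1) by (intro exI[of _ B']) (auto simp: B'_def)
      qed
      have t8: "8 \<le> t * N" unfolding tN using \<epsilon>0 k0 l0 by simp
      have cond: "\<epsilon> + ln (2 / \<delta>) \<le> (t * N / 2 - 3 * k) * ln (3 / 2)"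
      proof -
        have l: "1 / 3 \<le> ln (3 / 2 :: real)" using ln_le_minus_one[of "2 / 3 :: real"] by (simp add: ln_div)
        have "ln (2 / \<delta>) = ln 2 + ln (1 / \<delta>)" using \<delta> by (simp add: ln_div)
        then have "\<epsilon> + ln (2 / \<delta>) \<le> \<epsilon> + 1 + ln (1 / \<delta>)" using ln_2_less_1 by linarith
        also have "\<dots> = (3 * (\<epsilon> + 1 + ln (1 / \<delta>))) * (1 / 3)" by simp
        also have "\<dots> \<le> (3 * (\<epsilon> + 1 + ln (1 / \<delta>)) + 4) * ln (3 / 2)"
          using l \<epsilon>0 l0 by (intro mult_mono) auto
        also have "3 * (\<epsilon> + 1 + ln (1 / \<delta>)) + 4 = t * N / 2 - 3 * k" unfolding tN by (simp add: field_simps)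
        finally show ?thesis .
      qed
      have tK: "t \<le> K * (margin_rate V N \<rho> + ln (1 / \<delta>) / N)"
      proof -
        let ?r = "margin_rate V N \<rho>"
        have r: "1 / N \<le> ?r" using margin_rate_ge_inverse[OF V N \<rho>] .
        have r0: "0 \<le> ?r" by (simp add: margin_rate_def)
        have "6 * k / N = 192 * K2\<^sup>2 * (2 powr (- real J * (V + 2)) / \<rho>\<^sup>2)"
          using N by (simp add: k_def power_divide)
        also have "\<dots> \<le> 192 * K2\<^sup>2 * ?r" by (intro mult_left_mono J(2)) auto
        finally have a: "6 * k / N \<le> 192 * K2\<^sup>2 * ?r" .
        have "6 * \<epsilon> / N = 6 * K1 * (2 powr (real J * V) / N)" by (simp add: \<epsilon>_def)
        also have "\<dots> \<le> 6 * K1 * (2 powr V * ?r)" using 1(1) by (intro mult_left_mono J(1)) auto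
        finally have b: "6 * \<epsilon> / N \<le> 6 * K1 * 2 powr V * ?r" by simp
        have c: "6 * (ln (1 / \<delta>) / N) \<le> K * (ln (1 / \<delta>) / N)"
          unfolding K_def using l0 1(1) by (intro mult_right_mono add_increasing) auto
        have "t = 6 * k / N + 6 * \<epsilon> / N + 6 * (ln (1 / \<delta>) / N) + 14 * (1 / N)"
          using N by (simp add: t_def field_simps)
        also have "\<dots> \<le> 192 * K2\<^sup>2 * ?r + 6 * K1 * 2 powr V * ?r + K * (ln (1 / \<delta>) / N) + 14 * ?r"
          using a b c r by linarith
        also have "\<dots> = K * (?r + ln (1 / \<delta>) / N)" by (simp add: K_def algebra_simps)
        finally show ?thesis .
      qed
      have PhiG: "countable (\<phi> ` G)" "\<And>f. f \<in> \<phi> ` G \<Longrightarrow> f \<in> borel_measurable D"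
        using G meas by auto
      show ?thesis
      proof (rule relative_deviation_bound[OF P PhiG cover _ \<delta>(1) t8 cond, of "\<rho> / 4"], goal_cases)
        case (4 Bad)
        have "\<P>(z in D. snd z * g (fst z) \<le> \<rho> / 4) \<le> K * (margin_rate V N \<rho> + ln (1 / \<delta>) / N)
          + 4 * (\<Sum>i<N. indicator {..3 * \<rho> / 4} (snd (S i) * g (fst (S i)))) / N"
          if "S \<in> space (sample_measure N D) - Bad" "g \<in> G" for S g
        proof -
          have "\<rho> / 4 + 2 * (\<rho> / 4) = 3 * \<rho> / 4" by simp
          then show ?thesis
            using 4(3)[of S "\<phi> g"] that tK unfolding sample_measure_def \<phi>_def by auto
        qed
        then show ?case using 4(1,2) unfolding sample_measure_def by blast
      qed (use N in auto)
    qed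
    ultimately show ?case by blast
  qed
qed

end

section \<open>All margins and all ensembles at once\<close>

theorem theorem2:
  fixes X :: "(real ^ 'n) set"
    and \<Theta> :: "(real ^ 'd) set"
    and h :: "real ^ 'd \<Rightarrow> real ^ 'n \<Rightarrow> real"
    and D :: "((real ^ 'n) \<times> real) measure"
    and C V :: real
  assumes X_compact: "compact X"
    and \<Theta>_borel: "\<Theta> \<in> sets borel"
    and h_range: "\<And>\<theta> x. \<theta> \<in> \<Theta> \<Longrightarrow> x \<in> X \<Longrightarrow> h \<theta> x \<in> {-1..1}"
    and h_measurable: "(\<lambda>(\<theta>, x). h \<theta> x) \<in> borel_measurable (restrict_space borel (\<Theta> \<times> X))"
    and h_continuous: "\<And>\<theta>. \<theta> \<in> \<Theta> \<Longrightarrow> continuous_on X (h \<theta>)"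
    and D_prob: "D \<in> borel_prob_measures (X \<times> {-1, 1})"
    and C: "C > 1"
    and V: "V > 0"
    and covering: "\<And>\<epsilon>. \<epsilon> \<in> {0<..<1} \<Longrightarrow>
      (SUP m\<in>discrete_probs_on X.
         ereal_of_enat (covering_number (measure_pmf m) \<epsilon> (base_classifiers h \<Theta>)))
      \<le> ereal (C * \<epsilon> powr (- V))"
  shows "\<exists>K>0. \<forall>N\<ge>1. \<forall>\<delta>\<in>{0<..<1}.
    with_prob_at_least (sample_measure N D) (1 - \<delta>) (\<lambda>S.
      \<forall>f\<in>ensembles h \<Theta>.
        \<P>(z in D. snd z * f (fst z) \<le> 0)
        \<le> K / real N * ln (1 / \<delta>)
          + K * (INF \<rho>\<in>{0<..1}.
              \<P>(z in measure_pmf (empirical_pmf N S). snd z * f (fst z) \<le> \<rho>)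
              + \<rho> powr (- V / (V + 1)) * real N powr (- (V + 2) / (2 * (V + 1)))))"
proof -
  interpret uniform_entropy_class X \<Theta> h C V
    by unfold_locales (fact h_range h_measurable h_continuous C V covering)+
  obtain G where G: "countable G" "G \<subseteq> ensembles h \<Theta>"
    "\<And>f \<eta>. f \<in> ensembles h \<Theta> \<Longrightarrow> 0 < \<eta> \<Longrightarrow> \<exists>g\<in>G. \<forall>x\<in>X. \<bar>f x - g x\<bar> < \<eta>"
    using countable_uniformly_dense[OF X_compact continuous_on_ensemble] by metis
  have s: "sets D = sets (restrict_space borel (X \<times> {-1, 1}))" and P: "prob_space D"
    using D_prob by (auto simp: borel_prob_measures_def)
  have sp: "space D = X \<times> {-1, 1}" using sets_eq_imp_space_eq[OF s] by (simp add: space_restrict_space)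
  interpret D: prob_space D by (rule P)
  obtain K' where K': "K' > 0" and level: "\<And>N \<rho> \<delta>. N \<ge> 1 \<Longrightarrow> 0 < \<rho> \<Longrightarrow> \<rho> \<le> 1 \<Longrightarrow> 0 < \<delta> \<Longrightarrow> \<delta> < 1 \<Longrightarrow>
    (\<exists>Bad\<in>sets (sample_measure N D). measure (sample_measure N D) Bad \<le> \<delta> \<and>
      (\<forall>S\<in>space (sample_measure N D) - Bad. \<forall>g\<in>G.
        \<P>(z in D. snd z * g (fst z) \<le> \<rho> / 4) \<le> K' * (margin_rate V N \<rho> + ln (1 / \<delta>) / N)
          + 4 * (\<Sum>i<N. indicator {..3 * \<rho> / 4} (snd (S i) * g (fst (S i)))) / N))"
    using margin_bound_fixed_level[OF D_prob G(1,2)] by blast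
  define v where "v = V / (V + 1)"
  have v: "v > 0" using V by (simp add: v_def)
  define c where "c = 1 + 2 / v"
  have c: "c > 0" using v by (simp add: c_def add_pos_pos)
  \<comment> \<open>Here \<open>c\<close> is the cost of the union bound over margins, the factor 2
    comes from rounding \<open>\<rho>\<close> to a power of two, and 4 is the factor of the
    empirical term.\<close>
  define K where "K = 2 * K' * (1 + c) + 4"
  have K: "K > 0" "K' \<le> K" "4 \<le> K"
  proof -
    have "K = 2 * K' + 2 * (K' * c) + 4" by (simp add: K_def algebra_simps)
    then show "K > 0" "K' \<le> K" "4 \<le> K" using K' mult_pos_pos[OF K' c] by linarith+
  qed
  \<comment> \<open>The confidence spent on level \<open>k\<close> costs a term linear in
    \<open>k\<close>, whereas the rate at margin \<open>(1/2) ^ k\<close> grows like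
    \<open>2 powr (real k * v)\<close>.\<close>
  have level_count: "(real k + 1) / N \<le> c * margin_rate V N ((1/2) ^ k)" if N: "N \<ge> 1" for k N :: nat
  proof -
    have pw: "((1/2::real) ^ k) powr (- V / (V + 1)) = 2 powr (real k * v)"
      by (simp add: v_def power_one_over powr_minus_divide powr_realpow[symmetric] powr_powr powr_divide)
    have "1 + real k * v * ln 2 \<le> exp (real k * v * ln 2)" by (rule exp_ge_add_one_self)
    then have e: "1 + real k * v * ln 2 \<le> 2 powr (real k * v)" by (simp add: powr_def)
    have "real k * v * (1 / 2) \<le> real k * v * ln 2"
      using ln2_ge_two_thirds v by (intro mult_left_mono) auto
    then have "real k * v \<le> 2 * 2 powr (real k * v)" using e by linarith
    then have "real k \<le> 2 / v * 2 powr (real k * v)" using v by (simp add: field_simps)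
    moreover have "1 \<le> 2 powr (real k * v)" using v by (simp add: ge_one_powr_ge_zero)
    ultimately have "real k + 1 \<le> c * 2 powr (real k * v)" by (simp add: c_def distrib_right)
    then have "(real k + 1) / N \<le> c * 2 powr (real k * v) / N" by (intro divide_right_mono) auto
    also have "\<dots> \<le> c * margin_rate V N ((1/2) ^ k)"
      using margin_rate_ge[OF V N, of "(1/2) ^ k"] c mult_left_mono[of _ _ c] unfolding pw by fastforce
    finally show ?thesis .
  qed
  have "with_prob_at_least (sample_measure N D) (1 - \<delta>) (\<lambda>S.
      \<forall>f\<in>ensembles h \<Theta>.
        \<P>(z in D. snd z * f (fst z) \<le> 0)
        \<le> K / real N * ln (1 / \<delta>)
          + K * (INF \<rho>\<in>{0<..1}.
              \<P>(z in measure_pmf (empirical_pmf N S). snd z * f (fst z) \<le> \<rho>)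
              + \<rho> powr (- V / (V + 1)) * real N powr (- (V + 2) / (2 * (V + 1)))))"
    if N: "N \<ge> 1" and \<delta>: "\<delta> \<in> {0<..<1}" for N :: nat and \<delta> :: real
  proof -
    let ?M = "sample_measure N D"
    interpret M: prob_space ?M unfolding sample_measure_def by (intro prob_space_PiM P)
    define d where "d k = \<delta> * (1/2) ^ Suc k" for k :: nat
    have d: "0 < d k" "d k < 1" for k
    proof -
      have "\<delta> * (1/2) ^ Suc k < 1 * 1"
        using \<delta> power_le_one[of "1/2::real" "Suc k"] by (intro mult_less_le_imp_less) auto
      then show "0 < d k" "d k < 1" using \<delta> by (auto simp: d_def)
    qed
    have dsum: "d sums \<delta>" unfolding d_def using sums_mult[OF power_half_series, of \<delta>] by simp
    have sd: "summable d" "suminf d = \<delta>" using dsum by (simp_all add: sums_iff)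
    define ok where "ok k B \<longleftrightarrow> B \<in> sets ?M \<and> measure ?M B \<le> d k \<and>
      (\<forall>S\<in>space ?M - B. \<forall>g\<in>G.
        \<P>(z in D. snd z * g (fst z) \<le> (1/2) ^ k / 4) \<le> K' * (margin_rate V N ((1/2) ^ k) + ln (1 / d k) / N)
          + 4 * (\<Sum>i<N. indicator {..3 * (1/2) ^ k / 4} (snd (S i) * g (fst (S i)))) / N)" for k B
    have "\<exists>B. ok k B" for k
      unfolding ok_def by (rule level[OF N _ _ d, unfolded Bex_def]) (auto simp: power_le_one)
    then obtain Bad where "\<And>k. ok k (Bad k)" by metis
    then have Bad: "\<And>k. Bad k \<in> sets ?M" "\<And>k. measure ?M (Bad k) \<le> d k"
      "\<And>k S g. S \<in> space ?M - Bad k \<Longrightarrow> g \<in> G \<Longrightarrow>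
        \<P>(z in D. snd z * g (fst z) \<le> (1/2) ^ k / 4) \<le> K' * (margin_rate V N ((1/2) ^ k) + ln (1 / d k) / N)
          + 4 * (\<Sum>i<N. indicator {..3 * (1/2) ^ k / 4} (snd (S i) * g (fst (S i)))) / N"
      unfolding ok_def by blast+
    \<comment> \<open>Only countably many events are removed, so \<open>A\<close> is measurable
      although the assertion made on it ranges over all ensembles and all margins.\<close>
    define A where "A = space ?M - (\<Union>k. Bad k)"
    have sumBad: "summable (\<lambda>k. measure ?M (Bad k))"
      by (rule summable_comparison_test'[OF sd(1), of 0]) (use Bad(2) in \<open>simp add: measure_nonneg\<close>)
    have "measure ?M (\<Union>k. Bad k) \<le> (\<Sum>k. measure ?M (Bad k))"
      using Bad(1) sumBad by (intro M.finite_measure_subadditive_countably) auto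
    also have "\<dots> \<le> (\<Sum>k. d k)" by (rule suminf_le[OF Bad(2) sumBad sd(1)])
    also have "\<dots> = \<delta>" by (rule sd(2))
    finally have "measure ?M (\<Union>k. Bad k) \<le> \<delta>" .
    then have mA: "1 - \<delta> \<le> measure ?M A" unfolding A_def using Bad(1) by (subst M.prob_compl) auto
    have sA: "A \<in> sets ?M" unfolding A_def using Bad(1) by auto
    have "\<P>(z in D. snd z * f (fst z) \<le> 0)
        \<le> K / real N * ln (1 / \<delta>)
          + K * (INF \<rho>\<in>{0<..1}.
              \<P>(z in measure_pmf (empirical_pmf N S). snd z * f (fst z) \<le> \<rho>)
              + \<rho> powr (- V / (V + 1)) * real N powr (- (V + 2) / (2 * (V + 1))))"
      if S: "S \<in> A" and f: "f \<in> ensembles h \<Theta>" for S f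
    proof -
      let ?L = "\<P>(z in D. snd z * f (fst z) \<le> 0)" and ?l = "ln (1 / \<delta>) / N"
      let ?E = "\<lambda>\<rho>. \<P>(z in measure_pmf (empirical_pmf N S). snd z * f (fst z) \<le> \<rho>)"
      have l0: "0 \<le> ?l" using \<delta> by simp
      have bound: "?L \<le> K * ?l + K * (?E \<rho> + margin_rate V N \<rho>)" if \<rho>: "0 < \<rho>" "\<rho> \<le> 1" for \<rho>
      proof -
        obtain k where k: "(1/2) ^ k \<le> \<rho>" "\<rho> \<le> 2 * (1/2) ^ k" using dyadic_approximation[OF \<rho>] .
        define \<sigma> where "\<sigma> = (1/2::real) ^ k"
        have "\<sigma> > 0" by (simp add: \<sigma>_def)
        \<comment> \<open>With tolerance \<open>\<sigma> / 4\<close>, margin at most 0 for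
          \<open>f\<close> forces margin at most \<open>\<sigma> / 4\<close> for \<open>g\<close>,
          and margin at most \<open>3 * \<sigma> / 4\<close> for \<open>g\<close> forces margin at
          most \<open>\<sigma> \<le> \<rho>\<close> for \<open>f\<close>.\<close>
        obtain g where g: "g \<in> G" "\<forall>x\<in>X. \<bar>f x - g x\<bar> < \<sigma> / 4"
          using G(3)[OF f, of "\<sigma> / 4"] \<open>\<sigma> > 0\<close> by auto
        have close: "\<bar>snd z * f (fst z) - snd z * g (fst z)\<bar> < \<sigma> / 4" if "z \<in> space D" for z
        proof -
          have "\<bar>snd z\<bar> = 1" "fst z \<in> X" using that by (auto simp: sp)
          then show ?thesis using g(2) by (simp add: abs_mult flip: right_diff_distrib)
        qed
        have "continuous_on (X \<times> {-1, 1}) (\<lambda>z. snd z * g (fst z))"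
          using g(1) G(2) by (intro continuous_intros continuous_on_compose2[OF continuous_on_ensemble]) auto
        from borel_measurable_continuous_on_restrict[OF this]
        have [measurable]: "(\<lambda>z. snd z * g (fst z)) \<in> borel_measurable D"
          by (simp add: measurable_cong_sets[OF s refl])
        have "?L \<le> \<P>(z in D. snd z * g (fst z) \<le> \<sigma> / 4)"
        proof (rule D.finite_measure_mono)
          show "{z \<in> space D. snd z * f (fst z) \<le> 0} \<subseteq> {z \<in> space D. snd z * g (fst z) \<le> \<sigma> / 4}"
          proof safe
            fix a b assume "(a, b) \<in> space D" "snd (a, b) * f (fst (a, b)) \<le> 0"
            then show "snd (a, b) * g (fst (a, b)) \<le> \<sigma> / 4" using close[of "(a, b)"] by linarith
          qed
        qed measurable
        also have "\<dots> \<le> K' * (margin_rate V N \<sigma> + ln (1 / d k) / N)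
          + 4 * (\<Sum>i<N. indicator {..3 * \<sigma> / 4} (snd (S i) * g (fst (S i)))) / N"
          unfolding \<sigma>_def using S g(1) by (intro Bad(3)) (auto simp: A_def)
        also have "\<dots> \<le> K' * (2 * (1 + c) * margin_rate V N \<rho> + ?l) + 4 * ?E \<rho>"
        proof -
          have "ln (1 / d k) = ln (1 / \<delta>) + (real k + 1) * ln 2"
            using \<delta> by (simp add: d_def ln_div ln_mult ln_realpow algebra_simps)
          also have "\<dots> \<le> ln (1 / \<delta>) + (real k + 1) * 1"
            using ln_2_less_1 by (intro add_left_mono mult_left_mono) auto
          finally have "ln (1 / d k) / N \<le> ?l + (real k + 1) / N"
            unfolding add_divide_distrib[symmetric] by (intro divide_right_mono) auto
          then have "margin_rate V N \<sigma> + ln (1 / d k) / N \<le> ?l + (1 + c) * margin_rate V N \<sigma>"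
            using level_count[OF N, of k] by (simp add: \<sigma>_def algebra_simps)
          also have "\<dots> \<le> ?l + (1 + c) * (2 * margin_rate V N \<rho>)"
            using margin_rate_double[OF V \<rho>(1), of \<sigma> N] k(2) c unfolding \<sigma>_def
            by (intro add_left_mono mult_left_mono) auto
          finally have m1: "margin_rate V N \<sigma> + ln (1 / d k) / N \<le> 2 * (1 + c) * margin_rate V N \<rho> + ?l"
            by (simp add: algebra_simps)
          have "(\<Sum>i<N. indicator {..3 * \<sigma> / 4} (snd (S i) * g (fst (S i))))
              \<le> (\<Sum>i<N. of_bool (snd (S i) * f (fst (S i)) \<le> \<rho>) :: real)"
          proof (intro sum_mono)
            fix i assume "i \<in> {..<N}"
            then have Si: "S i \<in> space D"
              using S by (auto simp: A_def sample_measure_def space_PiM PiE_def Pi_def)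
            have "snd (S i) * f (fst (S i)) < snd (S i) * g (fst (S i)) + \<sigma> / 4"
              using close[OF Si] by linarith
            moreover have "\<sigma> \<le> \<rho>" using k(1) by (simp add: \<sigma>_def)
            ultimately have "snd (S i) * g (fst (S i)) \<le> 3 * \<sigma> / 4 \<Longrightarrow> snd (S i) * f (fst (S i)) \<le> \<rho>"
              by linarith
            then show "indicator {..3 * \<sigma> / 4} (snd (S i) * g (fst (S i)))
                \<le> (of_bool (snd (S i) * f (fst (S i)) \<le> \<rho>) :: real)"
              by (auto simp: indicator_def)
          qed
          then have m2: "4 * (\<Sum>i<N. indicator {..3 * \<sigma> / 4} (snd (S i) * g (fst (S i)))) / N \<le> 4 * ?E \<rho>"
            using N by (subst empirical_prob) (auto simp: divide_right_mono)
          show ?thesis using mult_left_mono[OF m1, of K'] K' m2 by linarith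
        qed
        also have "\<dots> = K' * ?l + 2 * K' * (1 + c) * margin_rate V N \<rho> + 4 * ?E \<rho>"
          by (simp add: algebra_simps)
        also have "\<dots> \<le> K * ?l + K * margin_rate V N \<rho> + K * ?E \<rho>"
          using K l0 by (intro add_mono mult_right_mono) (auto simp: K_def margin_rate_def)
        finally show ?thesis by (simp add: algebra_simps)
      qed
      \<comment> \<open>Solved for the bracket, the bound is a lower bound that does not depend on
        \<open>\<rho>\<close>, so it passes to the infimum.\<close>
      have "(?L - K * ?l) / K \<le> (INF \<rho>\<in>{0<..1}. ?E \<rho> + margin_rate V N \<rho>)"
      proof (rule cINF_greatest)
        show "{0<..1::real} \<noteq> {}" by (auto intro: exI[of _ 1])
        show "(?L - K * ?l) / K \<le> ?E \<rho> + margin_rate V N \<rho>" if "\<rho> \<in> {0<..1}" for \<rho>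
          using bound[of \<rho>] that K(1) by (simp add: divide_le_eq algebra_simps)
      qed
      then have "?L \<le> K * ?l + K * (INF \<rho>\<in>{0<..1}. ?E \<rho> + margin_rate V N \<rho>)"
        using K(1) by (simp add: divide_le_eq algebra_simps)
      then show ?thesis unfolding margin_rate_def by simp
    qed
    then show ?thesis unfolding with_prob_at_least_def using sA mA by blast
  qed
  then show ?thesis using K(1) by blast
qed

end
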